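(* For every $n$, the map $\tilde\Gamma:=\mathrm{jdt}\circ\Gamma$ is a bijection from the set $\mathbf M_n$ of Motzkin paths of length $n$ to the set of standard Young tableaux of straight shape of size $n$ with at most $3$ rows, and $$\mathrm{Des}(M)=\mathrm{Des}(\tilde\Gamma(M))\qquad\text{for all } M\in\mathbf M_n .$$
   Context: Motzkin paths. A Motzkin path of length $n$ is a lattice path from $(0,0)$ to $(n,0)$ with steps $U=(1,1)$, $D=(1,-1)$, $L=(1,0)$ that never passes below the $x$-axis; $\mathbf M_n$ is the set of these. The descent set $\mathrm{Des}(M)$ of $M\in\mathbf M_n$ is the set of $i\in\{1,\dots,n-1\}$ such that the $i$th and $(i+1)$st steps of $M$ are $UD$, $UL$ or $DL$ (in this order). Tableaux. Diagrams are drawn with rows numbered from top to bottom, left-justified. A standard Young tableau (SYT) of skew shape $\lambda/\mu$ with $n$ cells is a filling of the cells with $1,\dots,n$, each used once, increasing along rows from left to right and down columns from top to bottom. $\mathrm{SYT}(\lambda/\mu)$ is the set of these. The descent set of an SYT $T$ of size $n$ is $\mathrm{Des}(T)=\{i\in\{1,\dots,n-1\}: i+1\text{ is in a lower row than } i \text{ in } T\}$. The map $\Gamma$. For $M\in\mathbf M_n$ with $k$ steps $U$ (equivalently $k$ steps $D$), $\Gamma(M)$ is the SYT of skew shape $(n-k,n-k,n-2k)/(n-2k,n-2k)$ (whose rows have $k$, $k$, $n-2k$ cells) obtained by placing, for $i=1,\dots,n$, the entry $i$ in the first, second or third row according to whether the $i$th step of $M$ is $U$, $D$ or $L$, entries increasing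 from left to right in each row. The map $\mathrm{jdt}$. For an SYT $T$ of skew shape, $\mathrm{jdt}(T)$ is the SYT of straight shape obtained from $T$ by performing jeu de taquin slides until the shape is straight (the rectification of $T$). *)

theory Defs
  imports Main
begin

section \<open>Motzkin paths\<close>

datatype motzkin_step = Up | Down | Level

primrec rise :: "motzkin_step \<Rightarrow> int" where
  "rise Up = 1"
| "rise Down = -1"
| "rise Level = 0"

text \<open>A path starting at the origin is encoded by its word of steps; after \<open>i\<close> steps it is at
  the point \<open>(i, path_height w i)\<close>.\<close>

definition path_height :: "motzkin_step list \<Rightarrow> nat \<Rightarrow> int" where
  "path_height w i = (\<Sum>s\<leftarrow>take i w. rise s)"

definition motzkin_paths :: "nat \<Rightarrow> motzkin_step list set" where
  "motzkin_paths n =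
     {w. length w = n \<and> path_height w n = 0 \<and> (\<forall>i\<le>n. 0 \<le> path_height w i)}"

text \<open>Steps are numbered from 1, so the \<open>i\<close>th step of \<open>w\<close> is \<open>w ! (i - 1)\<close>.\<close>

definition path_Des :: "motzkin_step list \<Rightarrow> nat set" where
  "path_Des w =
     {i \<in> {1..<length w}. (w ! (i - 1), w ! i) \<in> {(Up, Down), (Up, Level), (Down, Level)}}"


section \<open>Skew shapes and standard Young tableaux\<close>

text \<open>Cells are pairs (row, column), both numbered from 0, rows from top to bottom.
  Trailing zeros are allowed in partitions. They do not affect the diagram.\<close>

type_synonym cell = "nat \<times> nat"

definition is_partition :: "nat list \<Rightarrow> bool" where
  "is_partition ps \<longleftrightarrow> sorted_wrt (\<ge>) ps"

definition young_diagram :: "nat list \<Rightarrow> cell set" where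
  "young_diagram ps = {(i, j). i < length ps \<and> j < ps ! i}"

definition is_skew_shape :: "nat list \<Rightarrow> nat list \<Rightarrow> bool" where
  "is_skew_shape outer inner \<longleftrightarrow>
     is_partition outer \<and> is_partition inner \<and> young_diagram inner \<subseteq> young_diagram outer"

definition skew_diagram :: "nat list \<Rightarrow> nat list \<Rightarrow> cell set" where
  "skew_diagram outer inner = young_diagram outer - young_diagram inner"

text \<open>A filling is a partial map whose domain is its set of cells.\<close>

type_synonym filling = "cell \<rightharpoonup> nat"

definition SYT :: "cell set \<Rightarrow> filling set" where
  "SYT C =
     {T. dom T = C \<and>
         bij_betw (\<lambda>c. the (T c)) C {1..card C} \<and>
         (\<forall>i j j' a b. T (i, j) = Some a \<and> T (i, j') = Some b \<and> j < j' \<longrightarrow> a < b) \<and>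
         (\<forall>i i' j a b. T (i, j) = Some a \<and> T (i', j) = Some b \<and> i < i' \<longrightarrow> a < b)}"

definition straight_SYT :: "nat \<Rightarrow> nat \<Rightarrow> filling set" where
  "straight_SYT n r =
     {T. \<exists>ps. is_partition ps \<and> length ps \<le> r \<and> sum_list ps = n \<and> T \<in> SYT (young_diagram ps)}"

definition tableau_Des :: "filling \<Rightarrow> nat set" where
  "tableau_Des T =
     {i \<in> {1..<card (dom T)}.
        \<exists>r c r' c'. T (r, c) = Some i \<and> T (r', c') = Some (i + 1) \<and> r < r'}"


section \<open>Jeu de taquin\<close>

text \<open>\<open>slide T c T'\<close>: moving the hole \<open>c\<close> of \<open>T\<close> until it has no neighbour to its right or below
  it produces \<open>T'\<close>. At each move the smaller of these neighbours goes into the hole.\<close>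

inductive slide :: "filling \<Rightarrow> cell \<Rightarrow> filling \<Rightarrow> bool" where
  stop: "\<lbrakk>T (i, Suc j) = None; T (Suc i, j) = None\<rbrakk> \<Longrightarrow> slide T (i, j) T"
| right: "\<lbrakk>T (i, Suc j) = Some a; \<forall>b. T (Suc i, j) = Some b \<longrightarrow> a < b;
           slide (T((i, j) := Some a, (i, Suc j) := None)) (i, Suc j) T'\<rbrakk>
          \<Longrightarrow> slide T (i, j) T'"
| down: "\<lbrakk>T (Suc i, j) = Some b; \<forall>a. T (i, Suc j) = Some a \<longrightarrow> b < a;
          slide (T((i, j) := Some b, (Suc i, j) := None)) (Suc i, j) T'\<rbrakk>
         \<Longrightarrow> slide T (i, j) T'"

definition inner_corner :: "nat list \<Rightarrow> cell \<Rightarrow> bool" where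
  "inner_corner inner c \<longleftrightarrow>
     (case c of (i, j) \<Rightarrow>
        (i, j) \<in> young_diagram inner \<and>
        (i, Suc j) \<notin> young_diagram inner \<and> (Suc i, j) \<notin> young_diagram inner)"

text \<open>A set of cells may be the skew diagram of more than one pair of shapes, and any such pair may
  be used for the next slide.\<close>

definition jdt_slide :: "filling \<Rightarrow> filling \<Rightarrow> bool" where
  "jdt_slide T T' \<longleftrightarrow>
     (\<exists>outer inner c. is_skew_shape outer inner \<and> T \<in> SYT (skew_diagram outer inner) \<and>
        inner_corner inner c \<and> slide T c T')"

definition is_straight :: "filling \<Rightarrow> bool" where
  "is_straight T \<longleftrightarrow> (\<exists>ps. is_partition ps \<and> dom T = young_diagram ps)"

text \<open>No order of the slides is prescribed. The definite description is meaningful only when all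
  orders lead to the same straight tableau.\<close>

definition jdt :: "filling \<Rightarrow> filling" where
  "jdt T = (THE S. jdt_slide\<^sup>*\<^sup>* T S \<and> is_straight S)"


section \<open>The map from Motzkin paths to tableaux\<close>

definition step_positions :: "motzkin_step \<Rightarrow> motzkin_step list \<Rightarrow> nat list" where
  "step_positions s w = [i \<leftarrow> [1..<Suc (length w)]. w ! (i - 1) = s]"

text \<open>The filling whose row \<open>i\<close> contains the list \<open>rows ! i\<close> from left to right, starting in
  column \<open>inner ! i\<close>.\<close>

definition skew_filling :: "nat list \<Rightarrow> nat list list \<Rightarrow> filling" where
  "skew_filling inner rows = (\<lambda>(i, j).
     if i < length rows \<and> inner ! i \<le> j \<and> j < inner ! i + length (rows ! i)
     then Some (rows ! i ! (j - inner ! i)) else None)"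

definition Gamma :: "motzkin_step list \<Rightarrow> filling" where
  "Gamma w =
     (let n = length w; k = count_list w Up
      in skew_filling [n - 2 * k, n - 2 * k, 0]
           [step_positions Up w, step_positions Down w, step_positions Level w])"

lemma length_step_positions: "length (step_positions s w) = count_list w s"
proof (induction w rule: rev_induct)
  case (snoc x w)
  have "[i \<leftarrow> [1..<Suc (length w)]. (w @ [x]) ! (i - 1) = s] = step_positions s w"
    unfolding step_positions_def by (rule filter_cong) (auto simp: nth_append)
  then show ?case using snoc by (simp add: step_positions_def)
qed (simp add: step_positions_def)

lemma dom_Gamma:
  assumes "w \<in> motzkin_paths n" and "k = count_list w Up"
  shows "dom (Gamma w) = skew_diagram [n - k, n - k, n - 2 * k] [n - 2 * k, n - 2 * k]"
proof -
  have "(\<Sum>s\<leftarrow>v. rise s) = int (count_list v Up) - int (count_list v Down)" for v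
  proof (induction v)
    case (Cons s v) then show ?case by (cases s) auto
  qed simp
  moreover have n: "length w = n" and "(\<Sum>s\<leftarrow>w. rise s) = 0"
    using assms(1) by (auto simp: motzkin_paths_def path_height_def)
  ultimately have D: "count_list w Down = k" using assms(2) by simp
  have "count_list v Up + count_list v Down + count_list v Level = length v" for v
  proof (induction v)
    case (Cons s v) then show ?case by (cases s) auto
  qed simp
  then have "k + k + count_list w Level = n" using D assms(2) n by metis
  then have L: "count_list w Level = n - 2 * k" and le: "2 * k \<le> n" by simp_all
  have "(i, j) \<in> dom (Gamma w) \<longleftrightarrow>
        (i, j) \<in> skew_diagram [n - k, n - k, n - 2 * k] [n - 2 * k, n - 2 * k]" for i j
  proof -
    consider "i = 0" | "i = 1" | "i = 2" | "i \<ge> 3" by linarith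
    then show ?thesis
      using D L le n assms(2)
      by cases (auto simp: Gamma_def Let_def skew_filling_def skew_diagram_def young_diagram_def
          length_step_positions numeral_2_eq_2 split: if_splits)
  qed
  then show ?thesis by auto
qed

definition Gamma_tilde :: "motzkin_step list \<Rightarrow> filling" where
  "Gamma_tilde = jdt \<circ> Gamma"

end

theory Submission
  imports Defs
begin

text \<open>Encode a filling with at most three rows by its row word, whose \<open>k\<close>th letter is the row of
  the entry \<open>k\<close>, with \<open>Up\<close>, \<open>Down\<close>, \<open>Level\<close> standing for the first, second and third row. The row
  word of \<open>Gamma w\<close> is \<open>w\<close>. Moving the hole to the right leaves the row word alone, and moving it
  down applies a crystal raising operator to it, which does not change the recording tableau of row
  insertion. The row word of a straight tableau is a Yamanouchi word, hence is its own
  recording word, and determines the tableau. Thus every rectification of \<open>Gamma w\<close> has the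
  recording word of \<open>w\<close> as its row word. This gives the uniqueness of the rectification and, since
  row insertion preserves descents, the statement on descent sets.

  Motzkin paths are the words whose insertion tableau is annihilated by both the raising and the
  lowering operator for the letters \<open>Up\<close> and \<open>Down\<close>. There is exactly one such semistandard tableau
  of each shape, so reverse insertion makes the recording word a bijection from Motzkin paths to
  Yamanouchi words.\<close>


section \<open>Row insertion of three-letter words\<close>

text \<open>A semistandard tableau in the letters \<open>Level < Down < Up\<close>: the first row of
  \<open>GT a b c d e f\<close> has \<open>a\<close> letters \<open>Level\<close>, \<open>b\<close> letters \<open>Down\<close> and \<open>c\<close> letters \<open>Up\<close>, the second
  has \<open>d\<close> letters \<open>Down\<close> and \<open>e\<close> letters \<open>Up\<close>, the third has \<open>f\<close> letters \<open>Up\<close>. With this reversed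
  order of the letters a descent of a word is a descent of its recording tableau.\<close>

datatype gt = GT nat nat nat nat nat nat

fun insert_step :: "motzkin_step \<Rightarrow> gt \<Rightarrow> gt" where
  "insert_step Up (GT a b c d e f) = GT a b (Suc c) d e f"
| "insert_step Down (GT a b c d e f) =
     (if c > 0 then GT a (Suc b) (c - 1) d (Suc e) f else GT a (Suc b) c d e f)"
| "insert_step Level (GT a b c d e f) =
     (if b > 0 then if e > 0 then GT (Suc a) (b - 1) c (Suc d) (e - 1) (Suc f)
                    else GT (Suc a) (b - 1) c (Suc d) e f
      else if c > 0 then GT (Suc a) b (c - 1) d (Suc e) f
      else GT (Suc a) b c d e f)"

text \<open>The letter codes the row in which the shape grows, by the same code as in row words of
  tableaux, so recording words can be compared with row words.\<close>

fun new_row :: "motzkin_step \<Rightarrow> gt \<Rightarrow> motzkin_step" where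
  "new_row Up (GT a b c d e f) = Up"
| "new_row Down (GT a b c d e f) = (if c > 0 then Down else Up)"
| "new_row Level (GT a b c d e f) =
     (if b > 0 then if e > 0 then Level else Down else if c > 0 then Down else Up)"

text \<open>Column strictness: a \<open>Down\<close> of the second row needs a \<open>Level\<close>
  above it, an \<open>Up\<close> of the second row a smaller letter, an \<open>Up\<close> of the
  third row a \<open>Down\<close>.\<close>

fun semistandard :: "gt \<Rightarrow> bool" where
  "semistandard (GT a b c d e f) \<longleftrightarrow> d \<le> a \<and> d + e \<le> a + b \<and> f \<le> d"

fun row_length :: "gt \<Rightarrow> motzkin_step \<Rightarrow> nat" where
  "row_length (GT a b c d e f) Up = a + b + c"
| "row_length (GT a b c d e f) Down = d + e"
| "row_length (GT a b c d e f) Level = f"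

primrec recording_from :: "gt \<Rightarrow> motzkin_step list \<Rightarrow> motzkin_step list" where
  "recording_from p [] = []"
| "recording_from p (x # xs) = new_row x p # recording_from (insert_step x p) xs"

abbreviation empty_gt :: gt where
  "empty_gt \<equiv> GT 0 0 0 0 0 0"

definition insertion :: "motzkin_step list \<Rightarrow> gt" where
  "insertion u = fold insert_step u empty_gt"

definition recording :: "motzkin_step list \<Rightarrow> motzkin_step list" where
  "recording u = recording_from empty_gt u"

lemma insertion_Nil [simp]: "insertion [] = empty_gt"
  by (simp add: insertion_def)

lemma insertion_snoc [simp]: "insertion (u @ [x]) = insert_step x (insertion u)"
  by (simp add: insertion_def)

lemma recording_from_append:
  "recording_from p (u @ v) = recording_from p u @ recording_from (fold insert_step u p) v"
  by (induction u arbitrary: p) auto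

lemma recording_Nil [simp]: "recording [] = []"
  by (simp add: recording_def)

lemma recording_snoc [simp]: "recording (u @ [x]) = recording u @ [new_row x (insertion u)]"
  by (simp add: recording_def insertion_def recording_from_append)

lemma length_recording_from [simp]: "length (recording_from p u) = length u"
  by (induction u arbitrary: p) auto

lemma length_recording [simp]: "length (recording u) = length u"
  by (simp add: recording_def)

lemma semistandard_insert_step: "semistandard p \<Longrightarrow> semistandard (insert_step x p)"
  by (cases p; cases x) auto

lemma semistandard_insertion: "semistandard (insertion u)"
  by (induction u rule: rev_induct) (auto intro: semistandard_insert_step)

lemma row_length_insert_step:
  "row_length (insert_step x p) s = row_length p s + (if new_row x p = s then 1 else 0)"
  by (cases p; cases x; cases s) auto

lemma row_length_insertion: "row_length (insertion u) s = count_list (recording u) s"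
proof (induction u rule: rev_induct)
  case Nil then show ?case by (cases s) auto
next
  case (snoc x u) then show ?case by (simp add: row_length_insert_step)
qed

text \<open>The crystal statistics for the pair of letters \<open>s\<close>, \<open>next_row s\<close>: over the inserted word,
  \<open>eps s\<close> is the largest excess of \<open>next_row s\<close> over \<open>s\<close> in a prefix and \<open>phi s\<close> the
  largest excess of \<open>s\<close> over \<open>next_row s\<close> in a suffix. The operator \<open>raise_gt s\<close> changes one
  \<open>next_row s\<close> into \<open>s\<close> and is meaningful only if \<open>eps s\<close> is positive.\<close>

fun eps :: "motzkin_step \<Rightarrow> gt \<Rightarrow> nat" where
  "eps Up (GT a b c d e f) = (d - f) + (b - e)"
| "eps Down (GT a b c d e f) = a - d"
| "eps Level p = 0"

fun phi :: "motzkin_step \<Rightarrow> gt \<Rightarrow> nat" where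
  "phi Up (GT a b c d e f) = c + (e - b)"
| "phi Down (GT a b c d e f) = b"
| "phi Level p = 0"

fun raise_gt :: "motzkin_step \<Rightarrow> gt \<Rightarrow> gt" where
  "raise_gt Up (GT a b c d e f) =
     (if b > e then GT a (b - 1) (Suc c) d e f else GT a b c (d - 1) (Suc e) f)"
| "raise_gt Down (GT a b c d e f) = GT (a - 1) (Suc b) c d e f"
| "raise_gt Level p = p"

fun next_row :: "motzkin_step \<Rightarrow> motzkin_step" where
  "next_row Up = Down"
| "next_row Down = Level"
| "next_row Level = Level"

section \<open>Raising operators and their commutation with insertion\<close>

lemma phi_insert_step:
  assumes "semistandard p" "s \<noteq> Level"
  shows "phi s (insert_step x p) =
    (if x = s then Suc (phi s p) else if x = next_row s then phi s p - 1 else phi s p)"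
  using assms by (cases p; cases x; cases s) auto

text \<open>The signature rule: in the order of insertion each \<open>next_row s\<close> cancels an
  earlier free \<open>s\<close>. \<open>phi s\<close> counts the \<open>s\<close> still free,
  \<open>eps s\<close> the \<open>next_row s\<close> that found none to cancel.\<close>

lemma eps_insert_step:
  assumes "semistandard p" "s \<noteq> Level"
  shows "eps s (insert_step x p) =
    (if x = next_row s \<and> phi s p = 0 then Suc (eps s p) else eps s p)"
  using assms by (cases p; cases x; cases s) auto

text \<open>Raising alters the last uncancelled \<open>next_row s\<close>. The condition on
  \<open>x\<close> keeps the inserted letter from becoming that one, so the same letter is altered
  before and after the insertion.\<close>

lemma raise_insert_step:
  assumes "semistandard p" "s \<noteq> Level" "eps s p > 0" "x = next_row s \<longrightarrow> phi s p > 0"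
  shows "insert_step x (raise_gt s p) = raise_gt s (insert_step x p)"
    and "new_row x (raise_gt s p) = new_row x p"
  using assms by (cases p; cases x; cases s; auto)+

text \<open>With \<open>phi s p = 0\<close> a newly inserted \<open>next_row s\<close> stays
  uncancelled and is the last such letter, hence it is the one that raising changes.\<close>

lemma raise_insert_next:
  assumes "semistandard p" "s \<noteq> Level" "phi s p = 0"
  shows "insert_step s p = raise_gt s (insert_step (next_row s) p)"
    and "new_row s p = new_row (next_row s) p"
  using assms by (cases p; cases s; auto)+

lemma next_row_neq: "s \<noteq> Level \<Longrightarrow> next_row s \<noteq> s"
  by (cases s) auto

text \<open>The bound \<open>m\<close> carries the induction: removing a final \<open>s\<close>
  lowers it by one, removing a final \<open>next_row s\<close> raises it by one. The later
  application has \<open>m = 0\<close>.\<close>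

lemma phi_insertion_le:
  assumes "s \<noteq> Level"
    and "\<And>k. count_list (drop k u) s \<le> count_list (drop k u) (next_row s) + m"
  shows "phi s (insertion u) \<le> m"
  using assms(2)
proof (induction u arbitrary: m rule: rev_induct)
  case Nil
  then show ?case by (cases s) auto
next
  case (snoc x u)
  note ss = semistandard_insertion[of u]
  have *: "count_list (drop k u) s + (if x = s then 1 else 0)
      \<le> count_list (drop k u) (next_row s) + (if x = next_row s then 1 else 0) + m" for k
    using snoc.prems[of "min k (length u)"] by (cases "k \<le> length u") (auto split: if_splits)
  \<comment> \<open>The one-letter suffix shows that \<open>m - 1\<close> below is not
    truncated.\<close>
  from *[of "length u"] have 1: "x = s \<Longrightarrow> m > 0"
    using next_row_neq[OF assms(1)] by auto
  show ?case
  proof (cases "x = s")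
    case True
    have "count_list (drop k u) s \<le> count_list (drop k u) (next_row s) + (m - 1)" for k
      using *[of k] 1 True next_row_neq[OF assms(1)] by auto
    then have "phi s (insertion u) \<le> m - 1"
      by (rule snoc.IH)
    then show ?thesis using True 1 ss assms(1) by (simp add: phi_insert_step)
  next
    case False
    then have "count_list (drop k u) s \<le> count_list (drop k u) (next_row s) +
        (m + (if x = next_row s then 1 else 0))" for k
      using *[of k] by simp
    then have "phi s (insertion u) \<le> m + (if x = next_row s then 1 else 0)"
      by (rule snoc.IH)
    then show ?thesis using False ss assms(1) by (auto simp: phi_insert_step split: if_splits)
  qed
qed

text \<open>The prefix condition makes a free \<open>s\<close> available whenever
  \<open>next_row s\<close> is read, so raising commutes past every letter of
  \<open>v\<close>.\<close>

lemma recording_from_raise: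
  assumes "s \<noteq> Level" "semistandard p" "eps s p > 0"
    and "\<And>k. count_list (take k v) (next_row s) \<le> count_list (take k v) s + phi s p"
  shows "recording_from (raise_gt s p) v = recording_from p v"
  using assms(2-)
proof (induction v arbitrary: p)
  case (Cons x v)
  note neq = next_row_neq[OF assms(1)]
  have pos: "x = next_row s \<longrightarrow> phi s p > 0"
    using Cons.prems(3)[of 1] neq by auto
  have "count_list (take k v) (next_row s) \<le> count_list (take k v) s + phi s (insert_step x p)" for k
    using Cons.prems(3)[of "Suc k"] pos neq Cons.prems(1) assms(1)
    by (auto simp: phi_insert_step split: if_splits)
  then have "recording_from (raise_gt s (insert_step x p)) v = recording_from (insert_step x p) v"
    using Cons.prems(1,2) assms(1)
    by (intro Cons.IH) (auto intro: semistandard_insert_step simp: eps_insert_step)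
  then show ?case
    using raise_insert_step[OF Cons.prems(1) assms(1) Cons.prems(2) pos] by simp
qed simp

text \<open>The displayed \<open>next_row s\<close> is the last uncancelled one: no \<open>s\<close>
  of \<open>u\<close> is free, and every \<open>next_row s\<close> of \<open>v\<close> cancels an
  \<open>s\<close> of \<open>v\<close>. So the two words differ by one raising.\<close>

lemma recording_raise:
  assumes "s \<noteq> Level"
    and "\<And>k. count_list (drop k u) s \<le> count_list (drop k u) (next_row s)"
    and "\<And>k. count_list (take k v) (next_row s) \<le> count_list (take k v) s"
  shows "recording (u @ s # v) = recording (u @ next_row s # v)"
proof -
  define p where "p = insertion u"
  have ss: "semistandard p" by (simp add: p_def semistandard_insertion)
  have phi: "phi s p = 0"
    using phi_insertion_le[of s u 0] assms(1,2) by (simp add: p_def)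
  have "recording_from (raise_gt s (insert_step (next_row s) p)) v =
      recording_from (insert_step (next_row s) p) v"
    using assms(1,3) ss phi
    by (intro recording_from_raise)
      (auto intro: semistandard_insert_step trans_le_add1 simp: eps_insert_step)
  then show ?thesis
    using raise_insert_next[OF ss assms(1) phi]
    by (simp add: recording_def recording_from_append p_def insertion_def)
qed


section \<open>Recording words\<close>

definition yamanouchi :: "motzkin_step list \<Rightarrow> bool" where
  "yamanouchi v \<longleftrightarrow> (\<forall>k. count_list (take k v) Level \<le> count_list (take k v) Down \<and>
     count_list (take k v) Down \<le> count_list (take k v) Up)"

lemma yamanouchi_Nil [simp]: "yamanouchi []"
  by (simp add: yamanouchi_def)

lemma yamanouchi_snoc:
  "yamanouchi (v @ [x]) \<longleftrightarrow> yamanouchi v \<and>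
     count_list (v @ [x]) Level \<le> count_list (v @ [x]) Down \<and>
     count_list (v @ [x]) Down \<le> count_list (v @ [x]) Up" (is "?l \<longleftrightarrow> ?r")
proof
  assume l: ?l
  have "yamanouchi v"
    unfolding yamanouchi_def
  proof
    fix k
    show "count_list (take k v) Level \<le> count_list (take k v) Down \<and>
     count_list (take k v) Down \<le> count_list (take k v) Up"
      using l[unfolded yamanouchi_def, rule_format, of "min k (length v)"]
      by (cases "k \<le> length v") auto
  qed
  with l[unfolded yamanouchi_def, rule_format, of "Suc (length v)"] show ?r by auto
next
  assume r: ?r
  show ?l
    unfolding yamanouchi_def
  proof
    fix k
    show "count_list (take k (v @ [x])) Level \<le> count_list (take k (v @ [x])) Down \<and>
     count_list (take k (v @ [x])) Down \<le> count_list (take k (v @ [x])) Up"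
      using r by (cases "k \<le> length v") (auto simp: yamanouchi_def)
  qed
qed

lemma yamanouchi_counts:
  "yamanouchi v \<Longrightarrow> count_list v Level \<le> count_list v Down \<and> count_list v Down \<le> count_list v Up"
  unfolding yamanouchi_def by (metis order_refl take_all)

text \<open>The prefix counts are the row lengths of the growing tableau, and column strictness
  makes these weakly decreasing.\<close>

lemma yamanouchi_recording: "yamanouchi (recording u)"
proof (induction u rule: rev_induct)
  case (snoc x u)
  have *: "row_length p Level \<le> row_length p Down \<and> row_length p Down \<le> row_length p Up"
    if "semistandard p" for p
    using that by (cases p) auto
  show ?case
    using snoc *[OF semistandard_insertion[of "u @ [x]"]]
    unfolding recording_snoc yamanouchi_snoc row_length_insertion by simp
qed simp

lemma recording_yamanouchi: "yamanouchi v \<Longrightarrow> recording v = v"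
proof -
  \<comment> \<open>The columns of heights 3, 2, 1 read \<open>Level\<close>, \<open>Down\<close>,
    \<open>Up\<close>; \<open>Down\<close>, \<open>Up\<close>; and \<open>Up\<close>: the
    semistandard tableau of its shape with \<open>eps Up\<close> and \<open>eps Down\<close>
    zero.\<close>
  have "recording v = v \<and>
    insertion v = (let x = count_list v Up; y = count_list v Down; z = count_list v Level
      in GT z (y - z) (x - y) z (y - z) z)" if "yamanouchi v"
    using that
  proof (induction v rule: rev_induct)
    case (snoc x v)
    then show ?case
      using yamanouchi_counts[of v]
      by (cases x) (auto simp: yamanouchi_snoc Let_def)
  qed (simp add: Let_def)
  then show "yamanouchi v \<Longrightarrow> recording v = v" by simp
qed

section \<open>Descents under row insertion\<close>

fun row_index :: "motzkin_step \<Rightarrow> nat" where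
  "row_index Up = 0"
| "row_index Down = 1"
| "row_index Level = 2"

lemma path_Des_row_index:
  "path_Des w = {i \<in> {1..<length w}. row_index (w ! (i - 1)) < row_index (w ! i)}"
  unfolding path_Des_def
proof (rule Collect_cong, rule conj_cong[OF refl])
  fix i
  show "((w ! (i - 1), w ! i) \<in> {(Up, Down), (Up, Level), (Down, Level)}) =
      (row_index (w ! (i - 1)) < row_index (w ! i))"
    by (cases "w ! (i - 1)"; cases "w ! i") auto
qed

text \<open>The row bumping lemma. A larger \<open>row_index\<close> means a smaller letter, and a
  strictly smaller second letter ends in a strictly lower row.\<close>

lemma new_row_less_iff:
  "row_index (new_row x p) < row_index (new_row y (insert_step x p)) \<longleftrightarrow> row_index x < row_index y"
  if "semistandard p"
  using that by (cases p; cases x; cases y) auto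

lemma nth_recording: "k < length u \<Longrightarrow> recording u ! k = new_row (u ! k) (insertion (take k u))"
proof (induction u rule: rev_induct)
  case (snoc x u)
  then show ?case by (cases "k < length u") (auto simp: nth_append less_Suc_eq)
qed simp

lemma path_Des_recording: "path_Des (recording u) = path_Des u"
proof -
  have "row_index (recording u ! (i - 1)) < row_index (recording u ! i) \<longleftrightarrow>
      row_index (u ! (i - 1)) < row_index (u ! i)" if "i \<in> {1..<length u}" for i
  proof -
    from that obtain j where j: "i = Suc j" "Suc j < length u" by (cases i) auto
    then show ?thesis
      by (simp add: nth_recording take_Suc_conv_app_nth new_row_less_iff semistandard_insertion)
  qed
  then show ?thesis unfolding path_Des_row_index by auto
qed

section \<open>Reverse insertion\<close>

lemma insert_step_inject:
  "insert_step x p = insert_step y q \<Longrightarrow> new_row x p = new_row y q \<Longrightarrow> x = y \<and> p = q"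
  by (cases p; cases q; cases x; cases y) (auto split: if_splits)

lemma insertion_recording_inject:
  "insertion u = insertion v \<Longrightarrow> recording u = recording v \<Longrightarrow> u = v"
proof (induction u arbitrary: v rule: rev_induct)
  case Nil
  then show ?case by (metis length_0_conv length_recording)
next
  case (snoc x u)
  from snoc.prems(2) obtain v' y where v: "v = v' @ [y]"
    by (metis length_recording length_0_conv rev_exhaust snoc_eq_iff_butlast)
  with snoc.prems have "insert_step x (insertion u) = insert_step y (insertion v')"
    "new_row x (insertion u) = new_row y (insertion v')" "recording u = recording v'"
    by auto
  with insert_step_inject snoc.IH v show ?case by blast
qed

text \<open>The hypotheses say that row \<open>s\<close> ends in a corner of the shape. Reverse
  bumping from there yields \<open>x\<close> and \<open>p\<close>: the expelled letter replaces the
  largest strictly smaller letter in the row above.\<close>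

lemma insert_step_surj:
  assumes "semistandard q" "row_length q s > 0" "s \<noteq> Level \<Longrightarrow> row_length q (next_row s) < row_length q s"
  shows "\<exists>x p. semistandard p \<and> insert_step x p = q \<and> new_row x p = s"
proof -
  obtain a b c d e f where q: "q = GT a b c d e f" by (cases q)
  show ?thesis
  proof (cases s)
    case Up
    consider "c > 0" | "c = 0" "b > 0" | "c = 0" "b = 0" by auto
    then show ?thesis
    proof cases
      case 1
      then show ?thesis using assms q Up
        by (intro exI[of _ Up] exI[of _ "GT a b (c - 1) d e f"]) auto
    next
      case 2
      then show ?thesis using assms q Up
        by (intro exI[of _ Down] exI[of _ "GT a (b - 1) c d e f"]) auto
    next
      case 3
      then show ?thesis using assms q Up
        by (intro exI[of _ Level] exI[of _ "GT (a - 1) b c d e f"]) auto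
    qed
  next
    case Down
    \<comment> \<open>The second row ends in \<open>Up\<close> if \<open>e > 0\<close>, else in
      \<open>Down\<close>. An \<open>Up\<close> drives out a \<open>Down\<close> of the first row if
      there is one, otherwise a \<open>Level\<close>; a \<open>Down\<close> drives out a
      \<open>Level\<close>.\<close>
    consider "e > 0" "b > 0" | "e > 0" "b = 0" | "e = 0" by auto
    then show ?thesis
    proof cases
      case 1
      then show ?thesis using assms q Down
        by (intro exI[of _ Down] exI[of _ "GT a (b - 1) (Suc c) d (e - 1) f"]) auto
    next
      case 2
      then show ?thesis using assms q Down
        by (intro exI[of _ Level] exI[of _ "GT (a - 1) b (Suc c) d (e - 1) f"]) auto
    next
      case 3
      then show ?thesis using assms q Down
        by (intro exI[of _ Level] exI[of _ "GT (a - 1) (Suc b) c (d - 1) e f"]) auto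
    qed
  next
    case Level
    \<comment> \<open>The \<open>Up\<close> of row three replaces a \<open>Down\<close> in row two,
      which replaces a \<open>Level\<close> in row one.\<close>
    then show ?thesis using assms q
      by (intro exI[of _ Level] exI[of _ "GT (a - 1) (Suc b) c (d - 1) (Suc e) (f - 1)"]) auto
  qed
qed

text \<open>The existence half of the Robinson-Schensted-Knuth correspondence: the last letter of a
  Yamanouchi word names the row of a removable corner.\<close>

lemma insertion_recording_surj:
  assumes "yamanouchi v" "semistandard q" "\<And>s. row_length q s = count_list v s"
  shows "\<exists>u. insertion u = q \<and> recording u = v"
  using assms
proof (induction v arbitrary: q rule: rev_induct)
  case Nil
  obtain a b c d e f where q: "q = GT a b c d e f" by (cases q)
  have "q = empty_gt"
    using Nil.prems(2) Nil.prems(3)[of Up] Nil.prems(3)[of Down] Nil.prems(3)[of Level] q by auto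
  then show ?case by (intro exI[of _ "[]"]) simp
next
  case (snoc s v)
  have v: "yamanouchi v" using snoc.prems(1) by (simp add: yamanouchi_snoc)
  have "row_length q s > 0" using snoc.prems(3) by simp
  moreover have "row_length q (next_row s) < row_length q s" if "s \<noteq> Level"
    using that snoc.prems(3) yamanouchi_counts[OF v] by (cases s) auto
  ultimately obtain x p where p: "semistandard p" "insert_step x p = q" "new_row x p = s"
    using insert_step_surj snoc.prems(2) by blast
  have "row_length p t = count_list v t" for t
    using snoc.prems(3)[of t] row_length_insert_step[of x p t] p by (auto split: if_splits)
  then obtain u where "insertion u = p" "recording u = v"
    using snoc.IH v p(1) by blast
  then show ?case using p by (intro exI[of _ "u @ [x]"]) simp
qed


section \<open>Motzkin paths and Yamanouchi words\<close>

lemma path_height_count: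
  "path_height w i = int (count_list (take i w) Up) - int (count_list (take i w) Down)"
proof -
  have "(\<Sum>s\<leftarrow>v. rise s) = int (count_list v Up) - int (count_list v Down)" for v
  proof (induction v)
    case (Cons s v) then show ?case by (cases s) auto
  qed simp
  then show ?thesis by (simp add: path_height_def)
qed

lemma phi_minus_eps_insertion:
  "int (phi Up (insertion u)) - int (eps Up (insertion u)) =
     int (count_list u Up) - int (count_list u Down)"
proof (induction u rule: rev_induct)
  case (snoc x u)
  then show ?case
    using semistandard_insertion[of u] by (cases x) (auto simp: phi_insert_step eps_insert_step)
qed simp

text \<open>While \<open>eps Up\<close> is zero, \<open>phi Up\<close> is the current height. So
  \<open>eps Up\<close> first grows exactly when the path steps below the axis.\<close>

lemma eps_insertion_eq_0_iff:
  "eps Up (insertion u) = 0 \<longleftrightarrow> (\<forall>i\<le>length u. count_list (take i u) Down \<le> count_list (take i u) Up)"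
proof (induction u rule: rev_induct)
  case (snoc x u)
  have "(\<forall>i\<le>length (u @ [x]). count_list (take i (u @ [x])) Down \<le> count_list (take i (u @ [x])) Up)
    \<longleftrightarrow> (\<forall>i\<le>length u. count_list (take i u) Down \<le> count_list (take i u) Up) \<and>
      count_list (u @ [x]) Down \<le> count_list (u @ [x]) Up"
    by (auto simp: le_Suc_eq)
  then show ?case
    using snoc phi_minus_eps_insertion[of u] semistandard_insertion[of u]
    by (cases x) (auto simp: eps_insert_step)
qed simp

text \<open>The two conditions below single out one semistandard tableau of each shape.\<close>

lemma motzkin_paths_iff:
  "w \<in> motzkin_paths n \<longleftrightarrow>
     length w = n \<and> eps Up (insertion w) = 0 \<and> phi Up (insertion w) = 0"
  using phi_minus_eps_insertion[of w] eps_insertion_eq_0_iff[of w]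
  by (auto simp: motzkin_paths_def path_height_count)

lemma bij_betw_recording:
  "bij_betw recording (motzkin_paths n) {v. yamanouchi v \<and> length v = n}"
proof (rule bij_betw_imageI)
  show "inj_on recording (motzkin_paths n)"
  proof (rule inj_onI)
    fix u v assume m: "u \<in> motzkin_paths n" "v \<in> motzkin_paths n" and eq: "recording u = recording v"
    \<comment> \<open>The equations \<open>c = 0\<close>, \<open>b = e\<close>, \<open>d = f\<close>
      leave three unknowns, fixed by the three row lengths.\<close>
    have *: "p = q" if "semistandard p" "semistandard q" "eps Up p = 0" "phi Up p = 0"
      "eps Up q = 0" "phi Up q = 0" "\<And>s. row_length p s = row_length q s" for p q
      using that(1-6) that(7)[of Up] that(7)[of Down] that(7)[of Level]
      by (cases p; cases q) auto
    have "insertion u = insertion v"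
      using m eq by (intro *) (auto simp: semistandard_insertion motzkin_paths_iff row_length_insertion)
    with eq insertion_recording_inject show "u = v" by blast
  qed
  show "recording ` motzkin_paths n = {v. yamanouchi v \<and> length v = n}" (is "_ = ?Y")
  proof
    show "recording ` motzkin_paths n \<subseteq> ?Y"
      by (auto simp: yamanouchi_recording motzkin_paths_def)
    show "?Y \<subseteq> recording ` motzkin_paths n"
    proof
      fix v assume v: "v \<in> ?Y"
      define x y z where "x = count_list v Up" and "y = count_list v Down" and "z = count_list v Level"
      \<comment> \<open>The solution of these equations for row lengths \<open>x\<close>,
        \<open>y\<close>, \<open>z\<close>.\<close>
      define q where "q = GT (x - y + z) (y - z) 0 z (y - z) z"
      have le: "z \<le> y" "y \<le> x" using v yamanouchi_counts by (auto simp: x_def y_def z_def)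
      have "row_length q s = count_list v s" for s
        using le by (cases s) (auto simp: q_def x_def y_def z_def)
      moreover have "semistandard q" using le by (simp add: q_def)
      ultimately obtain u where u: "insertion u = q" "recording u = v"
        using insertion_recording_surj v by blast
      then have "length u = n" using v by (metis (mono_tags) length_recording mem_Collect_eq)
      then have "u \<in> motzkin_paths n" using u by (simp add: motzkin_paths_iff q_def)
      with u show "v \<in> recording ` motzkin_paths n" by blast
    qed
  qed
qed


section \<open>Standard fillings and their row words\<close>

definition increasing :: "filling \<Rightarrow> bool" where
  "increasing T \<longleftrightarrow>
     (\<forall>i j j' a b. T (i, j) = Some a \<and> T (i, j') = Some b \<and> j < j' \<longrightarrow> a < b) \<and>
     (\<forall>i i' j a b. T (i, j) = Some a \<and> T (i', j) = Some b \<and> i < i' \<longrightarrow> a < b)"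

text \<open>Unlike \<open>SYT\<close> this fixes no shape, so it also covers the fillings met in the
  middle of a slide.\<close>

definition standard_filling :: "nat \<Rightarrow> filling \<Rightarrow> bool" where
  "standard_filling n T \<longleftrightarrow> inj_on T (dom T) \<and> ran T = {1..n} \<and> increasing T"

lemma increasing_row: "increasing T \<Longrightarrow> T (i, j) = Some a \<Longrightarrow> T (i, j') = Some b \<Longrightarrow> j < j' \<Longrightarrow> a < b"
  unfolding increasing_def by blast

lemma increasing_col: "increasing T \<Longrightarrow> T (i, j) = Some a \<Longrightarrow> T (i', j) = Some b \<Longrightarrow> i < i' \<Longrightarrow> a < b"
  unfolding increasing_def by blast

lemma inj_on_the_iff: "dom T = C \<Longrightarrow> inj_on (\<lambda>c. the (T c)) C \<longleftrightarrow> inj_on T C"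
  unfolding inj_on_def by (metis domD option.sel)

lemma image_the_eq_ran: "dom T = C \<Longrightarrow> (\<lambda>c. the (T c)) ` C = ran T"
  by (force simp: ran_def dom_def image_iff)

lemma standard_filling_card:
  assumes "standard_filling n T"
  shows "finite (dom T)" "card (dom T) = n"
proof -
  have b: "bij_betw (\<lambda>c. the (T c)) (dom T) {1..n}"
    using assms inj_on_the_iff[OF refl, of T] image_the_eq_ran[OF refl, of T]
    by (simp add: bij_betw_def standard_filling_def)
  show "finite (dom T)" using bij_betw_finite[OF b] by simp
  show "card (dom T) = n" using bij_betw_same_card[OF b] by simp
qed

lemma SYT_iff: "T \<in> SYT C \<longleftrightarrow> dom T = C \<and> standard_filling (card C) T"
proof -
  have "T \<in> SYT C \<longleftrightarrow> dom T = C \<and> bij_betw (\<lambda>c. the (T c)) C {1..card C} \<and> increasing T"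
    by (simp only: SYT_def increasing_def mem_Collect_eq)
  also have "\<dots> \<longleftrightarrow> dom T = C \<and> standard_filling (card C) T"
    using inj_on_the_iff[of T C] image_the_eq_ran[of T C]
    by (cases "dom T = C") (simp_all add: bij_betw_def standard_filling_def)
  finally show ?thesis .
qed

lemma standard_filling_SYT: "standard_filling n T \<Longrightarrow> T \<in> SYT (dom T)"
  by (simp add: SYT_iff standard_filling_card)

lemma standard_filling_inj:
  "standard_filling n T \<Longrightarrow> T p = Some k \<Longrightarrow> T q = Some k \<Longrightarrow> p = q"
  unfolding standard_filling_def inj_on_def by (metis domI)

lemma standard_filling_range: "standard_filling n T \<Longrightarrow> T p = Some k \<Longrightarrow> 1 \<le> k \<and> k \<le> n"
  unfolding standard_filling_def by (metis atLeastAtMost_iff ranI)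

lemma standard_filling_cell:
  "standard_filling n T \<Longrightarrow> 1 \<le> k \<Longrightarrow> k \<le> n \<Longrightarrow> \<exists>r c. T (r, c) = Some k"
proof -
  assume "standard_filling n T" "1 \<le> k" "k \<le> n"
  then have "k \<in> ran T" by (simp add: standard_filling_def)
  then show ?thesis by (auto simp: ran_def)
qed


section \<open>Row words and column sets\<close>

fun row_step :: "nat \<Rightarrow> motzkin_step" where
  "row_step 0 = Up"
| "row_step (Suc 0) = Down"
| "row_step (Suc (Suc r)) = Level"

lemma row_step_row_index [simp]: "row_step (row_index s) = s"
  by (cases s) (auto simp: numeral_2_eq_2)

lemma row_index_row_step: "r < 3 \<Longrightarrow> row_index (row_step r) = r"
  by (cases r rule: row_step.cases) auto

definition entry_row :: "filling \<Rightarrow> nat \<Rightarrow> nat" where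
  "entry_row T k = (THE r. \<exists>c. T (r, c) = Some k)"

text \<open>Rows below the third are also read as \<open>Level\<close>; the word shows the rows
  faithfully under \<open>within_rows 3\<close>.\<close>

definition row_word :: "nat \<Rightarrow> filling \<Rightarrow> motzkin_step list" where
  "row_word n T = map (\<lambda>k. row_step (entry_row T k)) [1..<Suc n]"

definition within_rows :: "nat \<Rightarrow> filling \<Rightarrow> bool" where
  "within_rows m T \<longleftrightarrow> (\<forall>r c. (r, c) \<in> dom T \<longrightarrow> r < m)"

text \<open>By \<open>count_rows\<close> the letter counts in a segment of the row word are sizes of
  these sets, so inequalities between counts reduce to inclusions.\<close>

definition row_cols :: "filling \<Rightarrow> nat \<Rightarrow> nat \<Rightarrow> nat \<Rightarrow> nat set" where
  "row_cols T r l m = {c. \<exists>k. T (r, c) = Some k \<and> l \<le> k \<and> k < m}"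

lemma within_rowsD: "within_rows m T \<Longrightarrow> T (r, c) = Some k \<Longrightarrow> r < m"
  unfolding within_rows_def by blast

lemma entry_row_eq: "standard_filling n T \<Longrightarrow> T (r, c) = Some k \<Longrightarrow> entry_row T k = r"
  unfolding entry_row_def by (rule the_equality) (auto dest: standard_filling_inj)

lemma length_row_word [simp]: "length (row_word n T) = n"
  by (simp add: row_word_def)

lemma nth_row_word: "k < n \<Longrightarrow> row_word n T ! k = row_step (entry_row T (Suc k))"
  by (simp add: row_word_def del: upt_Suc)

lemma finite_row_cols: "standard_filling n T \<Longrightarrow> finite (row_cols T r l m)"
proof (rule finite_subset)
  show "row_cols T r l m \<subseteq> snd ` dom T"
    unfolding row_cols_def by (force simp: image_iff)
qed (simp add: standard_filling_card)

lemma count_list_map_distinct: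
  "distinct xs \<Longrightarrow> count_list (map f xs) y = card {x \<in> set xs. f x = y}"
proof (induction xs)
  case (Cons x xs)
  have "{z \<in> set (x # xs). f z = y} =
      (if f x = y then insert x {z \<in> set xs. f z = y} else {z \<in> set xs. f z = y})"
    by auto
  then show ?case using Cons by auto
qed simp

lemma count_rows:
  assumes T: "standard_filling n T" "within_rows 3 T" and "1 \<le> l" "m \<le> Suc n"
  shows "count_list (map (\<lambda>k. row_step (entry_row T k)) [l..<m]) s =
    card (row_cols T (row_index s) l m)"
proof -
  let ?r = "row_index s"
  have "bij_betw (\<lambda>c. the (T (?r, c))) (row_cols T ?r l m)
      {k \<in> set [l..<m]. row_step (entry_row T k) = s}"
  proof (rule bij_betw_imageI)
    show "inj_on (\<lambda>c. the (T (?r, c))) (row_cols T ?r l m)"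
      unfolding row_cols_def using standard_filling_inj[OF T(1)] by (fastforce intro: inj_onI)
    show "(\<lambda>c. the (T (?r, c))) ` row_cols T ?r l m =
        {k \<in> set [l..<m]. row_step (entry_row T k) = s}"
    proof (intro equalityI subsetI)
      fix k assume "k \<in> (\<lambda>c. the (T (?r, c))) ` row_cols T ?r l m"
      then obtain c where "T (?r, c) = Some k" "l \<le> k" "k < m"
        unfolding row_cols_def by auto
      then show "k \<in> {k \<in> set [l..<m]. row_step (entry_row T k) = s}"
        using entry_row_eq[OF T(1)] by simp
    next
      fix k assume k: "k \<in> {k \<in> set [l..<m]. row_step (entry_row T k) = s}"
      then obtain r c where rc: "T (r, c) = Some k"
        using standard_filling_cell[OF T(1), of k] assms(3,4) by auto
      then have "?r = r"
        using k entry_row_eq[OF T(1)] within_rowsD[OF T(2)] row_index_row_step by force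
      then show "k \<in> (\<lambda>c. the (T (?r, c))) ` row_cols T ?r l m"
        using rc k unfolding row_cols_def by (force simp: image_iff)
    qed
  qed
  then show ?thesis
    by (simp add: count_list_map_distinct bij_betw_same_card)
qed

lemma count_take_row_word:
  assumes "standard_filling n T" "within_rows 3 T"
  shows "count_list (take k (row_word n T)) s = card (row_cols T (row_index s) 1 (Suc (min k n)))"
proof -
  have "take k (row_word n T) = map (\<lambda>k. row_step (entry_row T k)) [1..<Suc (min k n)]"
    unfolding row_word_def take_map by (cases "k \<le> n") (simp_all del: upt_Suc)
  then show ?thesis using count_rows[OF assms, of 1] by (simp del: upt_Suc)
qed

lemma tableau_Des_row_word:
  assumes "standard_filling n T" "within_rows 3 T"
  shows "tableau_Des T = path_Des (row_word n T)"
proof -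
  have "(\<exists>r c r' c'. T (r, c) = Some i \<and> T (r', c') = Some (i + 1) \<and> r < r') \<longleftrightarrow>
      row_index (row_word n T ! (i - 1)) < row_index (row_word n T ! i)" if "i \<in> {1..<n}" for i
  proof -
    have i: "1 \<le> i" "i < n" using that by auto
    obtain r c where r: "T (r, c) = Some i"
      using i standard_filling_cell[OF assms(1), of i] by force
    obtain r' c' where r': "T (r', c') = Some (i + 1)"
      using i standard_filling_cell[OF assms(1), of "i + 1"] by force
    have "row_index (row_word n T ! (i - 1)) = r" "row_index (row_word n T ! i) = r'"
      using that r r' entry_row_eq[OF assms(1)] within_rowsD[OF assms(2)]
      by (auto simp: nth_row_word row_index_row_step)
    moreover have "(\<exists>r c r' c'. T (r, c) = Some i \<and> T (r', c') = Some (i + 1) \<and> r < r') \<longleftrightarrow> r < r'"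
      using r r' standard_filling_inj[OF assms(1)] by blast
    ultimately show ?thesis by simp
  qed
  then show ?thesis
    unfolding tableau_Des_def path_Des_row_index standard_filling_card(2)[OF assms(1)] by auto
qed


section \<open>Slides\<close>

text \<open>The property of skew diagrams that a move of the hole needs; it is applied to the filled
  cells together with the hole.\<close>

definition order_convex :: "cell set \<Rightarrow> bool" where
  "order_convex D \<longleftrightarrow> (\<forall>i j i' j' k l. (i, j) \<in> D \<and> (i', j') \<in> D \<and>
     i \<le> k \<and> k \<le> i' \<and> j \<le> l \<and> l \<le> j' \<longrightarrow> (k, l) \<in> D)"

lemma order_convexD:
  "order_convex D \<Longrightarrow> (i, j) \<in> D \<Longrightarrow> (i', j') \<in> D \<Longrightarrow> i \<le> k \<Longrightarrow> k \<le> i' \<Longrightarrow> j \<le> l \<Longrightarrow> l \<le> j' \<Longrightarrow>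
    (k, l) \<in> D"
  unfolding order_convex_def by blast

section \<open>A single move of the hole\<close>

lemma move_entry:
  assumes "T p = Some a" "T q = None"
  shows "dom (T(q := Some a, p := None)) = insert q (dom T) - {p}"
    and "inj_on T (dom T) \<Longrightarrow> inj_on (T(q := Some a, p := None)) (dom (T(q := Some a, p := None)))"
    and "ran (T(q := Some a, p := None)) = ran T"
proof -
  let ?T = "T(q := Some a, p := None)"
  have pq: "p \<noteq> q" using assms by auto
  show "dom ?T = insert q (dom T) - {p}" by auto
  show "inj_on ?T (dom ?T)" if "inj_on T (dom T)"
  proof (rule inj_onI)
    have inj: "x = y" if "T x = Some k" "T y = Some k" for x y k
      using that \<open>inj_on T (dom T)\<close> by (metis domI inj_onD)
    fix x y assume "x \<in> dom ?T" "y \<in> dom ?T" and eq: "?T x = ?T y"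
    then obtain k where "?T x = Some k" by (meson domD)
    with eq have k: "?T x = Some k" "?T y = Some k" by simp_all
    have origin: "z \<noteq> p \<and> T (if z = q then p else z) = Some k" if "?T z = Some k" for z
      using that assms(1) pq by (auto split: if_splits)
    have "(if x = q then p else x) = (if y = q then p else y)"
      using origin[OF k(1)] origin[OF k(2)] inj by blast
    with origin[OF k(1)] origin[OF k(2)] show "x = y"
      by (auto split: if_splits)
  qed
  show "ran ?T = ran T"
  proof (intro equalityI subsetI)
    fix k assume "k \<in> ran ?T"
    then show "k \<in> ran T"
      unfolding ran_def using assms(1) by (auto split: if_splits)
  next
    fix k assume "k \<in> ran T"
    then obtain x where x: "T x = Some k" unfolding ran_def by auto
    show "k \<in> ran ?T"
    proof (cases "x = p")
      case True
      then have "?T q = Some k" using x assms pq by simp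
      then show ?thesis by (rule ranI)
    next
      case False
      then have "?T x = Some k" using x assms by auto
      then show ?thesis by (rule ranI)
    qed
  qed
qed

text \<open>Column \<open>j\<close> is the critical one. Below the hole \<open>less\<close> decides;
  an entry above the hole is smaller than its right neighbour, which exists by convexity and lies
  above \<open>a\<close>.\<close>

lemma increasing_move_right:
  assumes inc: "increasing T" and conv: "order_convex (insert (i, j) (dom T))"
    and a: "T (i, Suc j) = Some a"
    and less: "\<forall>b. T (Suc i, j) = Some b \<longrightarrow> a < b"
  shows "increasing (T((i, j) := Some a, (i, Suc j) := None))" (is "increasing ?T")
proof -
  note row = increasing_row[OF inc] and col = increasing_col[OF inc]
  have entry: "p = (i, j) \<and> x = a \<or> p \<noteq> (i, j) \<and> p \<noteq> (i, Suc j) \<and> T p = Some x"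
    if "?T p = Some x" for p x
    using that by (simp split: if_splits)
  have below: "a < y" if "T (r, j) = Some y" "i < r" for r y
  proof -
    have "(Suc i, j) \<in> insert (i, j) (dom T)"
      by (rule order_convexD[OF conv, of i j r j]) (use that in auto)
    then obtain b where b: "T (Suc i, j) = Some b" by auto
    then have "a < b" using less by blast
    also have "b \<le> y" using b that col[OF b that(1)] by (cases "r = Suc i") auto
    finally show ?thesis .
  qed
  have above: "x < a" if "T (r, j) = Some x" "r < i" for r x
  proof -
    have "(r, Suc j) \<in> insert (i, j) (dom T)"
      by (rule order_convexD[OF conv, of r j i "Suc j"]) (use that a in auto)
    then obtain z where z: "T (r, Suc j) = Some z" by auto
    then show ?thesis using row[OF that(1) z] col[OF z a that(2)] by simp
  qed
  show ?thesis
    unfolding increasing_def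
  proof (intro conjI allI impI; elim conjE)
    fix r c c' x y assume *: "?T (r, c) = Some x" "?T (r, c') = Some y" "c < c'"
    from entry[OF *(1)] entry[OF *(2)] *(3) consider
      "r = i" "x = a" "c = j" "T (r, c') = Some y" "Suc j < c'"
      | "r = i" "y = a" "c' = j" "T (r, c) = Some x"
      | "T (r, c) = Some x" "T (r, c') = Some y" by force
    then show "x < y"
      using row[of i "Suc j" a c' y] row[of i c x "Suc j" a] row[of r c x c' y] a *(3)
      by cases auto
  next
    fix r r' c x y assume *: "?T (r, c) = Some x" "?T (r', c) = Some y" "r < r'"
    from entry[OF *(1)] entry[OF *(2)] *(3) consider
      "r = i" "x = a" "c = j" "T (r', c) = Some y"
      | "r' = i" "y = a" "c = j" "T (r, c) = Some x"
      | "T (r, c) = Some x" "T (r', c) = Some y" by force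
    then show "x < y"
      using col[of r c x r' y] above[of r x] below[of r' y] *(3) by cases auto
  qed
qed

text \<open>The transposed argument: row \<open>i\<close> is critical, and an entry left of the hole
  is compared with \<open>b\<close> through the entry below it.\<close>

lemma increasing_move_down:
  assumes inc: "increasing T" and conv: "order_convex (insert (i, j) (dom T))"
    and b: "T (Suc i, j) = Some b"
    and less: "\<forall>a. T (i, Suc j) = Some a \<longrightarrow> b < a"
  shows "increasing (T((i, j) := Some b, (Suc i, j) := None))" (is "increasing ?T")
proof -
  note row = increasing_row[OF inc] and col = increasing_col[OF inc]
  have entry: "p = (i, j) \<and> x = b \<or> p \<noteq> (i, j) \<and> p \<noteq> (Suc i, j) \<and> T p = Some x"
    if "?T p = Some x" for p x
    using that by (simp split: if_splits)
  have after: "b < y" if "T (i, c) = Some y" "j < c" for c y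
  proof -
    have "(i, Suc j) \<in> insert (i, j) (dom T)"
      by (rule order_convexD[OF conv, of i j i c]) (use that in auto)
    then obtain a where a: "T (i, Suc j) = Some a" by auto
    then have "b < a" using less by blast
    also have "a \<le> y" using a that row[OF a that(1)] by (cases "c = Suc j") auto
    finally show ?thesis .
  qed
  have before: "x < b" if "T (i, c) = Some x" "c < j" for c x
  proof -
    have "(Suc i, c) \<in> insert (i, j) (dom T)"
      by (rule order_convexD[OF conv, of i c "Suc i" j]) (use that b in auto)
    then obtain z where z: "T (Suc i, c) = Some z" by auto
    then show ?thesis using col[OF that(1) z] row[OF z b that(2)] by simp
  qed
  show ?thesis
    unfolding increasing_def
  proof (intro conjI allI impI; elim conjE)
    fix r c c' x y assume *: "?T (r, c) = Some x" "?T (r, c') = Some y" "c < c'"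
    from entry[OF *(1)] entry[OF *(2)] *(3) consider
      "r = i" "x = b" "c = j" "T (r, c') = Some y"
      | "r = i" "y = b" "c' = j" "T (r, c) = Some x"
      | "T (r, c) = Some x" "T (r, c') = Some y" by force
    then show "x < y"
      using row[of r c x c' y] before[of c x] after[of c' y] *(3) by cases auto
  next
    fix r r' c x y assume *: "?T (r, c) = Some x" "?T (r', c) = Some y" "r < r'"
    from entry[OF *(1)] entry[OF *(2)] *(3) consider
      "r = i" "x = b" "c = j" "T (r', c) = Some y" "Suc i < r'"
      | "r' = i" "y = b" "c = j" "T (r, c) = Some x"
      | "T (r, c) = Some x" "T (r', c) = Some y" by force
    then show "x < y"
      using col[of "Suc i" j b r' y] col[of r j x "Suc i" b] col[of r c x r' y] b *(3)
      by cases auto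
  qed
qed

lemma entry_row_move:
  assumes "standard_filling n T" "T p = Some a" "T q = None" "k \<noteq> a"
  shows "entry_row (T(q := Some a, p := None)) k = entry_row T k"
proof -
  have "(T(q := Some a, p := None)) x = Some k \<longleftrightarrow> T x = Some k" for x
    using assms by auto
  then show ?thesis by (simp add: entry_row_def)
qed

lemma row_word_move_right:
  assumes "standard_filling n T" "T (i, j) = None" "T (i, Suc j) = Some a"
    and "standard_filling n (T((i, j) := Some a, (i, Suc j) := None))"
  shows "row_word n (T((i, j) := Some a, (i, Suc j) := None)) = row_word n T"
proof -
  have "entry_row (T((i, j) := Some a, (i, Suc j) := None)) k = entry_row T k" for k
  proof (cases "k = a")
    case True
    then show ?thesis
      using entry_row_eq[OF assms(4), of i j k] entry_row_eq[OF assms(1,3)] by simp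
  next
    case False
    then show ?thesis using entry_row_move[OF assms(1,3,2)] by blast
  qed
  then show ?thesis by (simp add: row_word_def)
qed

text \<open>Moving an entry up into the hole acts on the row word as a raising operator: the columns
  left of the hole inject the smaller entries of row \<open>i\<close> into row \<open>Suc i\<close>, and the columns right of
  the hole inject the larger entries of row \<open>Suc i\<close> into row \<open>i\<close>.\<close>

lemma recording_move_down:
  assumes T: "standard_filling n T" "within_rows 3 T"
    and conv: "order_convex (insert (i, j) (dom T))"
    and hole: "T (i, j) = None" and b: "T (Suc i, j) = Some b"
    and less: "\<forall>a. T (i, Suc j) = Some a \<longrightarrow> b < a"
    and T': "standard_filling n (T((i, j) := Some b, (Suc i, j) := None))"
  shows "recording (row_word n (T((i, j) := Some b, (Suc i, j) := None))) = recording (row_word n T)"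
proof -
  let ?T = "T((i, j) := Some b, (Suc i, j) := None)"
  define w where "w = (\<lambda>l m. map (\<lambda>k. row_step (entry_row T k)) [l..<m])"
  define s where "s = row_step i"
  have inc: "increasing T" using T(1) by (simp add: standard_filling_def)
  note row = increasing_row[OF inc] and col = increasing_col[OF inc]
  have i: "i < 2" using within_rowsD[OF T(2) b] by simp
  have s: "s \<noteq> Level" "row_index s = i" "next_row s = row_step (Suc i)" "row_index (next_row s) = Suc i"
    using i by (auto simp: s_def less_2_cases_iff)
  have bn: "1 \<le> b" "b \<le> n" using standard_filling_range[OF T(1) b] by auto
  \<comment> \<open>The row words before and after the move differ only in the letter for
    \<open>b\<close>.\<close>
  have upt: "[1..<Suc n] = [1..<b] @ b # [Suc b..<Suc n]"
  proof -
    have "[1..<Suc n] = [1..<b] @ [b..<Suc n]"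
      using bn by (metis le_Suc_eq le_add_diff_inverse upt_add_eq_append)
    then show ?thesis using bn by (simp add: upt_conv_Cons del: upt_Suc)
  qed
  have 1: "row_word n T = w 1 b @ next_row s # w (Suc b) (Suc n)"
    using entry_row_eq[OF T(1) b] s(3) unfolding row_word_def upt w_def by simp
  have "entry_row ?T b = i"
    using entry_row_eq[OF T', of i j b] by simp
  moreover have "entry_row ?T k = entry_row T k" if "k \<noteq> b" for k
    using entry_row_move[OF T(1) b hole that] .
  ultimately have 2: "row_word n ?T = w 1 b @ s # w (Suc b) (Suc n)"
    unfolding row_word_def upt w_def s_def by (auto simp del: upt_Suc)
  have left: "row_cols T i l b \<subseteq> row_cols T (Suc i) l b" for l
  proof
    fix c assume "c \<in> row_cols T i l b"
    then obtain x where x: "T (i, c) = Some x" "l \<le> x" "x < b" by (auto simp: row_cols_def)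
    have "c \<noteq> j" using x hole by auto
    \<comment> \<open>Entries of row \<open>i\<close> to the right of the hole exceed
      \<open>b\<close>, by convexity and \<open>less\<close>.\<close>
    moreover have "\<not> j < c"
    proof
      assume "j < c"
      have "(i, Suc j) \<in> insert (i, j) (dom T)"
        by (rule order_convexD[OF conv, of i j i c]) (use x \<open>j < c\<close> in auto)
      then obtain a where a: "T (i, Suc j) = Some a" by auto
      then have "b < a" using less by blast
      moreover have "a \<le> x" using a x row[OF a x(1)] \<open>j < c\<close> by (cases "c = Suc j") auto
      ultimately show False using x(3) by simp
    qed
    ultimately have cj: "c < j" by simp
    have "(Suc i, c) \<in> insert (i, j) (dom T)"
      by (rule order_convexD[OF conv, of i c "Suc i" j]) (use x b cj in auto)
    then obtain z where z: "T (Suc i, c) = Some z" by auto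
    then show "c \<in> row_cols T (Suc i) l b"
      using col[OF x(1) z] row[OF z b cj] x(2) by (auto simp: row_cols_def)
  qed
  have right: "row_cols T (Suc i) (Suc b) m \<subseteq> row_cols T i (Suc b) m" for m
  proof
    fix c assume "c \<in> row_cols T (Suc i) (Suc b) m"
    then obtain x where x: "T (Suc i, c) = Some x" "b < x" "x < m" by (auto simp: row_cols_def)
    have "\<not> c < j" using row[OF x(1) b] x(2) by auto
    moreover have "c \<noteq> j" using x b by auto
    ultimately have cj: "j < c" by simp
    have "(i, c) \<in> insert (i, j) (dom T)"
      by (rule order_convexD[OF conv, of i j "Suc i" c]) (use x cj in auto)
    then obtain z where z: "T (i, c) = Some z" using cj by auto
    have "(i, Suc j) \<in> insert (i, j) (dom T)"
      by (rule order_convexD[OF conv, of i j i c]) (use z cj in auto)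
    then obtain a where a: "T (i, Suc j) = Some a" by auto
    have "b < z" using less a z row[OF a z] cj by (cases "c = Suc j") auto
    moreover have "z < x" using col[OF z x(1)] by simp
    ultimately show "c \<in> row_cols T i (Suc b) m"
      using x z by (auto simp: row_cols_def)
  qed
  \<comment> \<open>\<open>left\<close> controls the suffixes before \<open>b\<close> and
    \<open>right\<close> the prefixes after it. Entries start at 1, hence the shift
    \<open>1 + k\<close>.\<close>
  have "recording (w 1 b @ s # w (Suc b) (Suc n)) = recording (w 1 b @ next_row s # w (Suc b) (Suc n))"
  proof (rule recording_raise[OF s(1)])
    fix k
    have "drop k (w 1 b) = w (1 + k) b" by (simp add: w_def drop_map)
    then show "count_list (drop k (w 1 b)) s \<le> count_list (drop k (w 1 b)) (next_row s)"
      using count_rows[OF T, of "1 + k" b] bn left[of "1 + k"] s finite_row_cols[OF T(1)]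
      by (simp add: w_def card_mono)
  next
    fix k
    have "take k (w (Suc b) (Suc n)) = w (Suc b) (min (Suc b + k) (Suc n))"
      unfolding w_def take_map by (cases "Suc b + k \<le> Suc n") (simp_all del: upt_Suc)
    then show "count_list (take k (w (Suc b) (Suc n))) (next_row s)
        \<le> count_list (take k (w (Suc b) (Suc n))) s"
      using count_rows[OF T, of "Suc b" "min (Suc b + k) (Suc n)"] right s finite_row_cols[OF T(1)]
      by (simp add: w_def card_mono)
  qed
  then show ?thesis using 1 2 by simp
qed

text \<open>The region \<open>insert c (dom T)\<close> does not change during a slide.\<close>

lemma slide_invariant:
  assumes "slide T c T'" "T c = None" "order_convex (insert c (dom T))" "standard_filling n T"
  shows "standard_filling n T' \<and>
    (\<exists>i j. T' (i, j) = None \<and> T' (i, Suc j) = None \<and> T' (Suc i, j) = None \<and>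
       insert (i, j) (dom T') = insert c (dom T)) \<and>
    (within_rows 3 T \<longrightarrow> within_rows 3 T' \<and> recording (row_word n T') = recording (row_word n T))"
  using assms
proof (induction rule: slide.induct)
  case (stop T i j)
  then show ?case by blast
next
  case (right T i j a T')
  let ?T = "T((i, j) := Some a, (i, Suc j) := None)"
  note move = move_entry[of T "(i, Suc j)" a "(i, j)", OF right.hyps(1) right.prems(1)]
  have D: "insert (i, Suc j) (dom ?T) = insert (i, j) (dom T)"
    using move(1) right.hyps(1) by auto
  have std: "standard_filling n ?T"
    using right.prems(3) move(2,3)
      increasing_move_right[OF _ right.prems(2) right.hyps(1,2)]
    by (simp only: standard_filling_def simp_thms)
  have rows: "within_rows 3 ?T" if "within_rows 3 T"
    using that right.hyps(1) move(1) unfolding within_rows_def by auto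
  have rec: "recording (row_word n ?T) = recording (row_word n T)"
    using row_word_move_right[OF right.prems(3,1) right.hyps(1) std] by (rule arg_cong)
  have "?T (i, Suc j) = None" by simp
  moreover have "order_convex (insert (i, Suc j) (dom ?T))"
    unfolding D by (fact right.prems(2))
  ultimately have IH: "standard_filling n T'"
    "\<exists>i' j'. T' (i', j') = None \<and> T' (i', Suc j') = None \<and> T' (Suc i', j') = None \<and>
       insert (i', j') (dom T') = insert (i, j) (dom T)"
    "within_rows 3 ?T \<Longrightarrow> within_rows 3 T'"
    "within_rows 3 ?T \<Longrightarrow> recording (row_word n T') = recording (row_word n ?T)"
    unfolding D[symmetric] using right.IH std by blast+
  show ?case
    using IH(1,2) IH(3)[OF rows] trans[OF IH(4)[OF rows] rec] by blast
next
  case (down T i j b T')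
  let ?T = "T((i, j) := Some b, (Suc i, j) := None)"
  note move = move_entry[of T "(Suc i, j)" b "(i, j)", OF down.hyps(1) down.prems(1)]
  have D: "insert (Suc i, j) (dom ?T) = insert (i, j) (dom T)"
    using move(1) down.hyps(1) by auto
  have std: "standard_filling n ?T"
    using down.prems(3) move(2,3)
      increasing_move_down[OF _ down.prems(2) down.hyps(1,2)]
    by (simp only: standard_filling_def simp_thms)
  have rows: "within_rows 3 ?T" if "within_rows 3 T"
    using that move(1) within_rowsD[OF that down.hyps(1)] unfolding within_rows_def by auto
  have rec: "recording (row_word n ?T) = recording (row_word n T)" if "within_rows 3 T"
    using recording_move_down[OF down.prems(3) that down.prems(2,1) down.hyps(1,2) std] .
  have "?T (Suc i, j) = None" by simp
  moreover have "order_convex (insert (Suc i, j) (dom ?T))"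
    unfolding D by (fact down.prems(2))
  ultimately have IH: "standard_filling n T'"
    "\<exists>i' j'. T' (i', j') = None \<and> T' (i', Suc j') = None \<and> T' (Suc i', j') = None \<and>
       insert (i', j') (dom T') = insert (i, j) (dom T)"
    "within_rows 3 ?T \<Longrightarrow> within_rows 3 T'"
    "within_rows 3 ?T \<Longrightarrow> recording (row_word n T') = recording (row_word n ?T)"
    unfolding D[symmetric] using down.IH std by blast+
  show ?case
    using IH(1,2) IH(3)[OF rows] trans[OF IH(4)[OF rows] rec] by blast
qed

text \<open>Each move takes the hole to the next antidiagonal, so fewer filled cells lie beyond it.
  Injectivity excludes equal neighbours, for which no rule of \<open>slide\<close> applies.\<close>

lemma slide_exists:
  assumes "finite (dom T)" "inj_on T (dom T)" "T (i, j) = None"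
  shows "\<exists>T'. slide T (i, j) T'"
  using assms
proof (induction "card {(r, c). (r, c) \<in> dom T \<and> i + j < r + c}" arbitrary: T i j rule: less_induct)
  case less
  let ?A = "\<lambda>T i j. {(r, c). (r, c) \<in> dom T \<and> i + j < r + c} :: cell set"
  have step: "\<exists>T'. slide (T((i, j) := Some a, q := None)) q T'"
    if q: "q = (i, Suc j) \<or> q = (Suc i, j)" and a: "T q = Some a" for q a
  proof -
    obtain r c where rc: "q = (r, c)" by (cases q)
    let ?T = "T((i, j) := Some a, q := None)"
    note move = move_entry[of T q a "(i, j)", OF a less.prems(3)]
    have "?A ?T r c \<subset> ?A T i j"
      using q a rc by (auto simp: move(1))
    moreover have "finite (?A T i j)"
      by (rule finite_subset[OF _ less.prems(1)]) auto
    ultimately have "card (?A ?T r c) < card (?A T i j)"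
      by (simp add: psubset_card_mono)
    from less.hyps[OF this] show ?thesis
      using less.prems move rc by simp
  qed
  show ?case
  proof (cases "T (i, Suc j)")
    case None
    show ?thesis
    proof (cases "T (Suc i, j)")
      case b: None
      then show ?thesis using None slide.stop by blast
    next
      case (Some b)
      then show ?thesis using None step[of "(Suc i, j)" b] slide.down[of T i j b] by auto
    qed
  next
    case a: (Some a)
    show ?thesis
    proof (cases "T (Suc i, j)")
      case None
      then show ?thesis using a step[of "(i, Suc j)" a] slide.right[of T i j a] by auto
    next
      case b: (Some b)
      have "a \<noteq> b"
      proof
        assume "a = b"
        then have "(i, Suc j) = (Suc i, j)"
          using a b less.prems(2) unfolding inj_on_def by (metis domI)
        then show False by simp
      qed
      then consider "a < b" | "b < a" by linarith
      then show ?thesis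
      proof cases
        case 1
        then show ?thesis using a b step[of "(i, Suc j)" a] slide.right[of T i j a] by auto
      next
        case 2
        then show ?thesis using a b step[of "(Suc i, j)" b] slide.down[of T i j b] by auto
      qed
    qed
  qed
qed


section \<open>Rectification\<close>

lemma is_partition_antimono: "is_partition ps \<Longrightarrow> i \<le> i' \<Longrightarrow> i' < length ps \<Longrightarrow> ps ! i' \<le> ps ! i"
  unfolding is_partition_def sorted_wrt_iff_nth_less by (cases "i = i'") auto

lemma young_diagram_down_closed:
  "is_partition ps \<Longrightarrow> (i', j') \<in> young_diagram ps \<Longrightarrow> i \<le> i' \<Longrightarrow> j \<le> j' \<Longrightarrow> (i, j) \<in> young_diagram ps"
  using is_partition_antimono[of ps i i'] by (auto simp: young_diagram_def)

lemma young_diagram_Sigma: "young_diagram ps = Sigma {..<length ps} (\<lambda>i. {..<ps ! i})"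
  by (auto simp: young_diagram_def)

lemma finite_young_diagram [simp]: "finite (young_diagram ps)"
  by (simp add: young_diagram_Sigma)

lemma card_young_diagram: "card (young_diagram ps) = sum_list ps"
  by (simp add: young_diagram_Sigma card_SigmaI sum_list_sum_nth lessThan_atLeast0)

lemma order_convex_skew_diagram: "is_skew_shape outer inner \<Longrightarrow> order_convex (skew_diagram outer inner)"
  unfolding order_convex_def is_skew_shape_def skew_diagram_def
  by (blast intro: young_diagram_down_closed)

lemma remove_corner:
  assumes "is_partition ps" "(i, j) \<in> young_diagram ps"
    and "(i, Suc j) \<notin> young_diagram ps" "(Suc i, j) \<notin> young_diagram ps"
  shows "\<exists>qs. is_partition qs \<and> young_diagram qs = young_diagram ps - {(i, j)}"
proof (intro exI conjI)
  let ?qs = "ps[i := j]"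
  have i: "i < length ps" "ps ! i = Suc j"
    using assms(2,3) by (auto simp: young_diagram_def)
  show "young_diagram ?qs = young_diagram ps - {(i, j)}"
    using i by (auto simp: young_diagram_def nth_list_update split: if_splits)
  have below: "ps ! k \<le> j" if "i < k" "k < length ps" for k
    using that assms(4) is_partition_antimono[OF assms(1), of "Suc i" k]
    by (auto simp: young_diagram_def)
  show "is_partition ?qs"
    unfolding is_partition_def sorted_wrt_iff_nth_less
  proof (intro allI impI)
    fix k l assume kl: "k < l" "l < length ?qs"
    then show "?qs ! l \<le> ?qs ! k"
      using i below is_partition_antimono[OF assms(1), of k l]
      by (auto simp: nth_list_update)
  qed
qed

lemma inner_corner_exists:
  assumes "young_diagram inner \<noteq> {}"
  shows "\<exists>c. inner_corner inner c"
proof -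
  define m where "m = Max ((\<lambda>(i, j). i + j) ` young_diagram inner)"
  have "m \<in> (\<lambda>(i, j). i + j) ` young_diagram inner"
    unfolding m_def using assms by (intro Max_in) auto
  then obtain i j where ij: "(i, j) \<in> young_diagram inner" "i + j = m" by auto
  have "i' + j' \<le> m" if "(i', j') \<in> young_diagram inner" for i' j'
    unfolding m_def using that by (intro Max_ge) force+
  from this[of i "Suc j"] this[of "Suc i" j] have "inner_corner inner (i, j)"
    using ij by (auto simp: inner_corner_def)
  then show ?thesis by blast
qed

text \<open>Filling the hole gives the skew diagram of a smaller inner shape. This yields convexity
  of the region and the inner shape after the slide.\<close>

lemma skew_hole:
  assumes skew: "is_skew_shape outer inner" and dom: "dom T = skew_diagram outer inner"
    and c: "inner_corner inner (i, j)"
  shows "T (i, j) = None"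
    and "\<exists>inner'. is_skew_shape outer inner' \<and> young_diagram inner' = young_diagram inner - {(i, j)} \<and>
      insert (i, j) (dom T) = skew_diagram outer inner'"
proof -
  have c': "(i, j) \<in> young_diagram inner" "(i, Suc j) \<notin> young_diagram inner"
    "(Suc i, j) \<notin> young_diagram inner"
    using c by (auto simp: inner_corner_def)
  have "(i, j) \<notin> dom T" using c' dom by (simp add: skew_diagram_def)
  then show "T (i, j) = None" by blast
  obtain inner' where "is_partition inner'" "young_diagram inner' = young_diagram inner - {(i, j)}"
    using remove_corner[of inner i j] c' skew by (auto simp: is_skew_shape_def)
  then show "\<exists>inner'. is_skew_shape outer inner' \<and> young_diagram inner' = young_diagram inner - {(i, j)} \<and>
      insert (i, j) (dom T) = skew_diagram outer inner'"
    using skew c' dom by (intro exI[of _ inner']) (auto simp: is_skew_shape_def skew_diagram_def)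
qed

lemma jdt_slide_invariant:
  assumes "jdt_slide T T'" "standard_filling n T" "within_rows 3 T"
  shows "standard_filling n T' \<and> within_rows 3 T' \<and> recording (row_word n T') = recording (row_word n T)"
proof -
  from assms(1) obtain outer inner i j where *: "is_skew_shape outer inner"
    "T \<in> SYT (skew_diagram outer inner)" "inner_corner inner (i, j)" "slide T (i, j) T'"
    unfolding jdt_slide_def by auto
  then have dom: "dom T = skew_diagram outer inner" by (simp add: SYT_iff)
  note hole = skew_hole[OF *(1) dom *(3)]
  have "order_convex (insert (i, j) (dom T))"
    using hole(2) order_convex_skew_diagram by metis
  from slide_invariant[OF *(4) hole(1) this assms(2)] assms(3) show ?thesis by blast
qed

lemma jdt_slides_invariant:
  assumes "jdt_slide\<^sup>*\<^sup>* T T'" "standard_filling n T" "within_rows 3 T"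
  shows "standard_filling n T' \<and> within_rows 3 T' \<and> recording (row_word n T') = recording (row_word n T)"
  using assms
proof (induction rule: rtranclp_induct)
  case (step T' T'')
  then show ?case using jdt_slide_invariant[of T' T'' n] by simp
qed simp

text \<open>The hole starts at a corner of \<open>inner\<close> and stops at a corner of
  \<open>outer\<close>; each shape loses that cell.\<close>

lemma jdt_slide_skew_exists:
  assumes skew: "is_skew_shape outer inner" and T: "T \<in> SYT (skew_diagram outer inner)"
    and ne: "young_diagram inner \<noteq> {}"
  shows "\<exists>T' outer' inner'. jdt_slide T T' \<and> is_skew_shape outer' inner' \<and>
    T' \<in> SYT (skew_diagram outer' inner') \<and> card (young_diagram inner') < card (young_diagram inner)"
proof -
  have dom: "dom T = skew_diagram outer inner" and "standard_filling (card (skew_diagram outer inner)) T"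
    using T by (simp_all add: SYT_iff)
  then have std: "standard_filling (card (dom T)) T" by simp
  from inner_corner_exists[OF ne] obtain i j where c: "inner_corner inner (i, j)" by auto
  note hole = skew_hole[OF skew dom c]
  from hole(2) obtain inner' where inner': "is_skew_shape outer inner'"
    "young_diagram inner' = young_diagram inner - {(i, j)}"
    "insert (i, j) (dom T) = skew_diagram outer inner'" by blast
  obtain T' where T': "slide T (i, j) T'"
    using slide_exists[of T i j] hole(1) std standard_filling_card(1)[OF std]
    by (auto simp: standard_filling_def)
  have conv: "order_convex (insert (i, j) (dom T))"
    using inner' order_convex_skew_diagram by metis
  from slide_invariant[OF T' hole(1) conv std] obtain k l where
    std': "standard_filling (card (dom T)) T'" and kl: "T' (k, l) = None" "T' (k, Suc l) = None"
      "T' (Suc k, l) = None" "insert (k, l) (dom T') = skew_diagram outer inner'"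
    using inner'(3) by metis
  have mem: "(k, l) \<in> skew_diagram outer inner'" using kl(4) by blast
  \<comment> \<open>The two neighbours are outside the region, and also outside
    \<open>inner'\<close>, whose diagram would otherwise contain \<open>(k, l)\<close>.\<close>
  have end_corner: "(k, Suc l) \<notin> young_diagram outer" "(Suc k, l) \<notin> young_diagram outer"
  proof -
    have "(k, Suc l) \<notin> skew_diagram outer inner'" "(Suc k, l) \<notin> skew_diagram outer inner'"
      unfolding kl(4)[symmetric] using kl(1-3) by auto
    moreover have "(k, Suc l) \<notin> young_diagram inner'" "(Suc k, l) \<notin> young_diagram inner'"
      using mem young_diagram_down_closed[of inner' k "Suc l" k l]
        young_diagram_down_closed[of inner' "Suc k" l k l] inner'(1)
      by (auto simp: skew_diagram_def is_skew_shape_def)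
    ultimately show "(k, Suc l) \<notin> young_diagram outer" "(Suc k, l) \<notin> young_diagram outer"
      by (auto simp: skew_diagram_def)
  qed
  have "is_partition outer" "(k, l) \<in> young_diagram outer"
    using inner'(1) mem by (auto simp: is_skew_shape_def skew_diagram_def)
  from remove_corner[OF this end_corner] obtain outer' where
    outer': "is_partition outer'" "young_diagram outer' = young_diagram outer - {(k, l)}" by blast
  have skew': "is_skew_shape outer' inner'"
    using inner'(1) outer' mem by (auto simp: is_skew_shape_def skew_diagram_def)
  have "(k, l) \<notin> dom T'" using kl(1) by blast
  then have "dom T' = skew_diagram outer inner' - {(k, l)}" using kl(4) by blast
  then have "dom T' = skew_diagram outer' inner'"
    using outer'(2) by (auto simp: skew_diagram_def)
  then have "T' \<in> SYT (skew_diagram outer' inner')"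
    using standard_filling_SYT[OF std'] by simp
  moreover have "jdt_slide T T'"
    unfolding jdt_slide_def using skew T c T' by blast
  moreover have "card (young_diagram inner') < card (young_diagram inner)"
    unfolding inner'(2) using c by (intro psubset_card_mono) (auto simp: inner_corner_def)
  ultimately show ?thesis using skew' by blast
qed

lemma rectification_exists:
  assumes "is_skew_shape outer inner" "T \<in> SYT (skew_diagram outer inner)"
  shows "\<exists>S. jdt_slide\<^sup>*\<^sup>* T S \<and> is_straight S"
  using assms
proof (induction "card (young_diagram inner)" arbitrary: outer inner T rule: less_induct)
  case less
  show ?case
  proof (cases "young_diagram inner = {}")
    case True
    then have "is_straight T"
      using less.prems by (auto simp: is_straight_def is_skew_shape_def SYT_iff skew_diagram_def)
    then show ?thesis by blast
  next
    case False
    from jdt_slide_skew_exists[OF less.prems False] less.hyps show ?thesis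
      by (meson converse_rtranclp_into_rtranclp)
  qed
qed

section \<open>Straight tableaux as Yamanouchi words\<close>

lemma straight_SYT_iff:
  "S \<in> straight_SYT n m \<longleftrightarrow> standard_filling n S \<and> within_rows m S \<and> is_straight S"
proof
  assume "S \<in> straight_SYT n m"
  then obtain ps where ps: "is_partition ps" "length ps \<le> m" "sum_list ps = n" "S \<in> SYT (young_diagram ps)"
    unfolding straight_SYT_def by auto
  then have "dom S = young_diagram ps" "standard_filling n S"
    by (auto simp: SYT_iff card_young_diagram)
  with ps show "standard_filling n S \<and> within_rows m S \<and> is_straight S"
    by (auto simp: is_straight_def within_rows_def young_diagram_def)
next
  assume S: "standard_filling n S \<and> within_rows m S \<and> is_straight S"
  then obtain ps where ps: "is_partition ps" "dom S = young_diagram ps" by (auto simp: is_straight_def)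
  \<comment> \<open>The parts cut off are zero because of \<open>within_rows m S\<close>.\<close>
  let ?qs = "take m ps"
  have "young_diagram ps = young_diagram ?qs"
    using S ps(2) by (auto simp: within_rows_def young_diagram_def)
  moreover have "is_partition ?qs"
    using ps(1) by (simp add: is_partition_def sorted_wrt_take)
  ultimately show "S \<in> straight_SYT n m"
    using S ps(2) standard_filling_SYT[of n S] standard_filling_card[of n S]
    unfolding straight_SYT_def by (intro CollectI exI[of _ ?qs]) (auto simp: card_young_diagram)
qed

lemma is_straight_down_closed:
  "is_straight S \<Longrightarrow> S (i', j') = Some x \<Longrightarrow> i \<le> i' \<Longrightarrow> j \<le> j' \<Longrightarrow> \<exists>y. S (i, j) = Some y"
  unfolding is_straight_def using young_diagram_down_closed by (metis domD domI)

text \<open>Each cell below the first row has a smaller entry above it, so among the entries below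
  any bound row \<open>Suc i\<close> occupies columns that row \<open>i\<close> occupies
  too.\<close>

lemma yamanouchi_row_word:
  assumes "S \<in> straight_SYT n 3"
  shows "yamanouchi (row_word n S)"
proof -
  have S: "standard_filling n S" "within_rows 3 S" "is_straight S"
    using assms by (auto simp: straight_SYT_iff)
  have inc: "increasing S" using S(1) by (simp add: standard_filling_def)
  have "row_cols S (Suc i) 1 m \<subseteq> row_cols S i 1 m" for i m
  proof
    fix c assume "c \<in> row_cols S (Suc i) 1 m"
    then obtain x where x: "S (Suc i, c) = Some x" "x < m" by (auto simp: row_cols_def)
    then obtain y where y: "S (i, c) = Some y"
      using is_straight_down_closed[OF S(3), of "Suc i" c x i c] by auto
    then show "c \<in> row_cols S i 1 m"
      using x increasing_col[OF inc y x(1)] standard_filling_range[OF S(1) y]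
      by (auto simp: row_cols_def)
  qed
  then have "card (row_cols S (Suc i) 1 m) \<le> card (row_cols S i 1 m)" for i m
    by (simp add: card_mono finite_row_cols[OF S(1)])
  from this[of 0] this[of 1] show ?thesis
    by (simp add: yamanouchi_def count_take_row_word[OF S(1,2)] numeral_2_eq_2)
qed

text \<open>Rows start in column 0 and have no gaps, so the column of \<open>k\<close> is the number
  of smaller entries in its row. Thus the row word determines the tableau.\<close>

lemma straight_cell:
  assumes S: "S \<in> straight_SYT n 3" and rc: "S (r, c) = Some k"
  shows "r = row_index (row_word n S ! (k - 1))"
    and "c = count_list (take (k - 1) (row_word n S)) (row_step r)"
proof -
  have std: "standard_filling n S" "within_rows 3 S" "is_straight S"
    using S by (auto simp: straight_SYT_iff)
  have inc: "increasing S" using std(1) by (simp add: standard_filling_def)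
  have k: "1 \<le> k" "k \<le> n" using standard_filling_range[OF std(1) rc] by auto
  have r: "row_index (row_step r) = r" using within_rowsD[OF std(2) rc] by (rule row_index_row_step)
  show "r = row_index (row_word n S ! (k - 1))"
    using k r entry_row_eq[OF std(1) rc] by (simp add: nth_row_word)
  have "row_cols S r 1 k = {..<c}"
  proof (intro equalityI subsetI)
    fix c' assume "c' \<in> row_cols S r 1 k"
    then obtain x where x: "S (r, c') = Some x" "x < k" by (auto simp: row_cols_def)
    then show "c' \<in> {..<c}"
      using increasing_row[OF inc rc x(1)] rc by (cases c c' rule: linorder_cases) auto
  next
    fix c' assume c': "c' \<in> {..<c}"
    then obtain x where x: "S (r, c') = Some x"
      using is_straight_down_closed[OF std(3) rc, of r c'] by auto
    then show "c' \<in> row_cols S r 1 k"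
      using c' increasing_row[OF inc x rc] standard_filling_range[OF std(1) x]
      by (auto simp: row_cols_def)
  qed
  moreover have "Suc (min (k - 1) n) = k" using k by simp
  ultimately show "c = count_list (take (k - 1) (row_word n S)) (row_step r)"
    by (simp add: count_take_row_word[OF std(1,2)] r)
qed

lemma inj_on_row_word: "inj_on (row_word n) (straight_SYT n 3)"
proof (rule inj_onI)
  have *: "S' p = Some k" if S: "S \<in> straight_SYT n 3" "S' \<in> straight_SYT n 3"
    "row_word n S = row_word n S'" and p: "S p = Some k" for S S' p k
  proof -
    obtain r c where rc: "p = (r, c)" by (cases p)
    have "1 \<le> k \<and> k \<le> n"
      using standard_filling_range p S(1) unfolding straight_SYT_iff by blast
    then obtain r' c' where rc': "S' (r', c') = Some k"
      using standard_filling_cell S(2) unfolding straight_SYT_iff by blast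
    have "r = r'"
      using straight_cell(1)[OF S(1)] straight_cell(1)[OF S(2) rc'] p rc S(3) by simp
    moreover have "c = c'"
      using straight_cell(2)[OF S(1)] straight_cell(2)[OF S(2) rc'] p rc S(3) \<open>r = r'\<close> by simp
    ultimately show ?thesis using rc rc' by simp
  qed
  fix S S' assume S: "S \<in> straight_SYT n 3" "S' \<in> straight_SYT n 3" "row_word n S = row_word n S'"
  show "S = S'"
  proof
    fix p
    show "S p = S' p"
      using *[OF S, of p] *[OF S(2,1) S(3)[symmetric], of p] by (cases "S p"; cases "S' p") auto
  qed
qed


section \<open>The tableau of a path\<close>

lemma set_step_positions: "set (step_positions s w) = {k \<in> {1..length w}. w ! (k - 1) = s}"
  by (auto simp: step_positions_def simp del: upt_Suc)

lemma sorted_step_positions: "sorted_wrt (<) (step_positions s w)"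
  unfolding step_positions_def by (rule sorted_wrt_filter) (simp del: upt_Suc)

lemma step_positions_append:
  "step_positions s (v @ w) = step_positions s v @ map (\<lambda>k. length v + k) (step_positions s w)"
proof -
  have "[1..<Suc (length (v @ w))] = [1..<Suc (length v)] @ map (\<lambda>k. length v + k) [1..<Suc (length w)]"
    by (rule nth_equalityI) (auto simp: nth_append simp del: upt_Suc)
  moreover have "[i \<leftarrow> [1..<Suc (length v)]. (v @ w) ! (i - 1) = s] = step_positions s v"
    unfolding step_positions_def by (rule filter_cong) (auto simp: nth_append)
  moreover have "[i \<leftarrow> [1..<Suc (length w)]. (v @ w) ! (length v + i - 1) = s] = step_positions s w"
    unfolding step_positions_def
  proof (rule filter_cong[OF refl])
    fix i assume "i \<in> set [1..<Suc (length w)]"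
    then have "length v + i - 1 = length v + (i - 1)" by auto
    then show "((v @ w) ! (length v + i - 1) = s) = (w ! (i - 1) = s)" by simp
  qed
  ultimately show ?thesis
    by (simp add: step_positions_def filter_map comp_def del: upt_Suc)
qed

text \<open>Cutting the word after \<open>b\<close> letters separates the positions up to
  \<open>b\<close> from the later ones. This turns the prefix condition on a path into comparisons
  within columns.\<close>

lemma nth_step_positions_le_iff:
  assumes "j < length (step_positions s w)"
  shows "step_positions s w ! j \<le> b \<longleftrightarrow> j < count_list (take b w) s"
proof -
  have split: "step_positions s w =
      step_positions s (take b w) @ map (\<lambda>k. length (take b w) + k) (step_positions s (drop b w))"
    using step_positions_append[of s "take b w" "drop b w"] by simp
  have le: "x \<le> b" if "x \<in> set (step_positions s (take b w))" for x
    using that by (auto simp: set_step_positions)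
  \<comment> \<open>If \<open>drop b w\<close> is nonempty, then
    \<open>length (take b w) = b\<close>.\<close>
  have gr: "x > length (take b w) \<and> drop b w \<noteq> []"
    if "x \<in> set (map (\<lambda>k. length (take b w) + k) (step_positions s (drop b w)))" for x
    using that by (auto simp: set_step_positions)
  show ?thesis
  proof (cases "j < count_list (take b w) s")
    case True
    then have "step_positions s w ! j \<in> set (step_positions s (take b w))"
      by (subst split) (simp add: nth_append length_step_positions)
    then show ?thesis using True le by blast
  next
    case False
    have mem: "(xs @ ys) ! j \<in> set ys" if "length xs \<le> j" "j < length (xs @ ys)" for xs ys :: "nat list"
      using that by (simp add: nth_append)
    have "step_positions s w ! j \<in>
        set (map (\<lambda>k. length (take b w) + k) (step_positions s (drop b w)))"
      unfolding split
      by (rule mem) (use False assms split in \<open>simp_all only: length_step_positions not_less\<close>)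
    from gr[OF this] False show ?thesis by auto
  qed
qed

lemma Gamma_cell:
  "Gamma w (i, j) = Some x \<longleftrightarrow>
     (\<exists>s l. i = row_index s \<and> l < length (step_positions s w) \<and> x = step_positions s w ! l \<and>
       j = (if s = Level then 0 else length w - 2 * count_list w Up) + l)"
proof -
  let ?m = "length w - 2 * count_list w Up"
  have steps: "(\<exists>s. P s) \<longleftrightarrow> P Up \<or> P Down \<or> P Level" for P
    by (metis motzkin_step.exhaust)
  have shift: "(\<exists>l. i = r \<and> l < n \<and> x = f l \<and> j = m + l) \<longleftrightarrow>
      i = r \<and> m \<le> j \<and> j < m + n \<and> f (j - m) = x" for r n m and f :: "nat \<Rightarrow> nat"
    by (auto intro: exI[of _ "j - m"])
  consider "i = 0" | "i = 1" | "i = 2" | "i \<ge> 3" by linarith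
  then show ?thesis
    unfolding steps shift
    by cases (auto simp: Gamma_def Let_def skew_filling_def)
qed

lemma standard_Gamma:
  assumes w: "w \<in> motzkin_paths n"
  shows "standard_filling n (Gamma w)" "within_rows 3 (Gamma w)" "row_word n (Gamma w) = w"
proof -
  have n: "length w = n" using w by (simp add: motzkin_paths_def)
  have row: "1 \<le> x \<and> x \<le> n \<and> r = row_index (w ! (x - 1))" if x: "Gamma w (r, c) = Some x" for r c x
  proof -
    from x obtain s where "r = row_index s" "x \<in> set (step_positions s w)"
      unfolding Gamma_cell using nth_mem by blast
    then show ?thesis by (simp add: set_step_positions n)
  qed
  have same: "l < l' \<longleftrightarrow> step_positions s w ! l < step_positions s w ! l'"
    if "l < length (step_positions s w)" "l' < length (step_positions s w)" for s l l'
    using sorted_step_positions[of s w] that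
    unfolding sorted_wrt_iff_nth_less by (metis linorder_neqE_nat less_asym less_irrefl)
  have inj_index: "s = t" if "row_index s = row_index t" for s t
    using that row_step_row_index by metis
  \<comment> \<open>The path is never below the axis, so when a \<open>Down\<close> step occurs, the
    \<open>Up\<close> step with the same index has already occurred.\<close>
  have updown: "step_positions Up w ! l < step_positions Down w ! l"
    if "l < length (step_positions Up w)" "l < length (step_positions Down w)" for l
  proof -
    let ?b = "step_positions Down w ! l"
    have "?b \<in> set (step_positions Down w)" "step_positions Up w ! l \<in> set (step_positions Up w)"
      using that by simp_all
    then have b: "?b \<le> n" "step_positions Up w ! l \<noteq> ?b" by (auto simp: set_step_positions n)
    have "0 \<le> path_height w ?b" using w b(1) by (simp add: motzkin_paths_def)
    then have "count_list (take ?b w) Down \<le> count_list (take ?b w) Up"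
      by (simp add: path_height_count)
    moreover have "l < count_list (take ?b w) Down"
      using nth_step_positions_le_iff[OF that(2), of ?b] by simp
    ultimately have "step_positions Up w ! l \<le> ?b"
      using nth_step_positions_le_iff[OF that(1), of ?b] by simp
    then show ?thesis using b(2) by simp
  qed
  show "within_rows 3 (Gamma w)"
    unfolding within_rows_def
  proof (intro allI impI)
    fix r c assume "(r, c) \<in> dom (Gamma w)"
    then obtain x where "Gamma w (r, c) = Some x" by auto
    then show "r < 3" using row[of r c x] by (cases "w ! (x - 1)") auto
  qed
  show std: "standard_filling n (Gamma w)"
    unfolding standard_filling_def increasing_def
  proof (intro conjI allI impI; (elim conjE)?)
    show "inj_on (Gamma w) (dom (Gamma w))"
    proof (rule inj_onI)
      fix p q assume "p \<in> dom (Gamma w)" "q \<in> dom (Gamma w)" and eq: "Gamma w p = Gamma w q"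
      then obtain x r c r' c' where x: "p = (r, c)" "q = (r', c')" "Gamma w (r, c) = Some x"
        "Gamma w (r', c') = Some x" by (metis domD surj_pair)
      from x(3) obtain s l where 1: "r = row_index s" "l < length (step_positions s w)"
        "x = step_positions s w ! l"
        "c = (if s = Level then 0 else length w - 2 * count_list w Up) + l"
        unfolding Gamma_cell by blast
      from x(4) obtain t l' where 2: "r' = row_index t" "l' < length (step_positions t w)"
        "x = step_positions t w ! l'"
        "c' = (if t = Level then 0 else length w - 2 * count_list w Up) + l'"
        unfolding Gamma_cell by blast
      have "r = r'" using row[OF x(3)] row[OF x(4)] by simp
      then have st: "s = t" using inj_index 1 2 by blast
      then have "l = l'" using same[of l s l'] same[of l' s l] 1 2 by (metis less_irrefl linorder_neqE_nat)
      then show "p = q" using x 1 2 st \<open>r = r'\<close> by simp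
    qed
    show "ran (Gamma w) = {1..n}"
    proof (intro equalityI subsetI)
      fix x assume "x \<in> ran (Gamma w)"
      then show "x \<in> {1..n}" using row by (auto simp: ran_def)
    next
      fix x assume "x \<in> {1..n}"
      then have "x \<in> set (step_positions (w ! (x - 1)) w)" by (auto simp: set_step_positions n)
      then show "x \<in> ran (Gamma w)"
        unfolding in_set_conv_nth using Gamma_cell ranI by metis
    qed
  next
    fix r c c' x y assume *: "Gamma w (r, c) = Some x" "Gamma w (r, c') = Some y" "c < c'"
    from *(1) obtain s l where 1: "r = row_index s" "l < length (step_positions s w)"
      "x = step_positions s w ! l" "c = (if s = Level then 0 else length w - 2 * count_list w Up) + l"
      unfolding Gamma_cell by blast
    from *(2) obtain t l' where 2: "r = row_index t" "l' < length (step_positions t w)"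
      "y = step_positions t w ! l'" "c' = (if t = Level then 0 else length w - 2 * count_list w Up) + l'"
      unfolding Gamma_cell by blast
    have "s = t" using inj_index 1(1) 2(1) by blast
    then show "x < y" using same[of l s l'] 1 2 *(3) by simp
  next
    fix r r' c x y assume *: "Gamma w (r, c) = Some x" "Gamma w (r', c) = Some y" "r < r'"
    from *(1) obtain s l where 1: "r = row_index s" "l < length (step_positions s w)"
      "x = step_positions s w ! l" "c = (if s = Level then 0 else length w - 2 * count_list w Up) + l"
      unfolding Gamma_cell by blast
    from *(2) obtain t l' where 2: "r' = row_index t" "l' < length (step_positions t w)"
      "y = step_positions t w ! l'" "c = (if t = Level then 0 else length w - 2 * count_list w Up) + l'"
      unfolding Gamma_cell by blast
    \<comment> \<open>The third row ends before the column in which the other two rows begin, so no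
      column meets both.\<close>
    have "t \<noteq> Level"
    proof
      assume t: "t = Level"
      then have "s \<noteq> Level" using *(3) 1 2 by auto
      then have c: "length w - 2 * count_list w Up \<le> c" using 1 by simp
      have "(2, c) \<in> dom (Gamma w)" using *(2) 2(1) t by auto
      then have "c < n - 2 * count_list w Up"
        unfolding dom_Gamma[OF w refl] by (auto simp: skew_diagram_def young_diagram_def)
      then show False using c n by simp
    qed
    then have "s = Up" "t = Down" using *(3) 1 2 by (cases s; cases t; simp)+
    then show "x < y" using updown[of l] 1 2 by simp
  qed
  show "row_word n (Gamma w) = w"
  proof (rule nth_equalityI)
    fix k assume "k < length (row_word n (Gamma w))"
    then have k: "k < n" by simp
    then obtain r c where rc: "Gamma w (r, c) = Some (Suc k)"
      using standard_filling_cell[OF std, of "Suc k"] by auto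
    then show "row_word n (Gamma w) ! k = w ! k"
      using row[OF rc] entry_row_eq[OF std rc] k by (simp add: nth_row_word)
  qed (simp add: n)
qed

lemma Gamma_tilde_correct:
  assumes w: "w \<in> motzkin_paths n"
  shows "Gamma_tilde w \<in> straight_SYT n 3" "row_word n (Gamma_tilde w) = recording w"
proof -
  note G = standard_Gamma[OF w]
  have straight: "S \<in> straight_SYT n 3 \<and> row_word n S = recording w"
    if "jdt_slide\<^sup>*\<^sup>* (Gamma w) S" "is_straight S" for S
  proof -
    have inv: "standard_filling n S" "within_rows 3 S" "recording (row_word n S) = recording w"
      using jdt_slides_invariant[OF that(1) G(1,2)] G(3) by auto
    then have "S \<in> straight_SYT n 3" using that(2) by (simp add: straight_SYT_iff)
    then show ?thesis using inv(3) recording_yamanouchi[OF yamanouchi_row_word] by auto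
  qed
  define k where "k = count_list w Up"
  note dom = dom_Gamma[OF w k_def]
  have "is_skew_shape [n - k, n - k, n - 2 * k] [n - 2 * k, n - 2 * k]"
    by (auto simp: is_skew_shape_def is_partition_def young_diagram_def less_Suc_eq numeral_2_eq_2)
  moreover have "Gamma w \<in> SYT (skew_diagram [n - k, n - k, n - 2 * k] [n - 2 * k, n - 2 * k])"
    using standard_filling_SYT[OF G(1)] dom by simp
  ultimately obtain S where S: "jdt_slide\<^sup>*\<^sup>* (Gamma w) S" "is_straight S"
    using rectification_exists by blast
  \<comment> \<open>Equal row words force all rectifications to coincide, so the definite
    description in \<open>jdt\<close> denotes \<open>S\<close>.\<close>
  have "jdt (Gamma w) = S"
    unfolding jdt_def
  proof (rule the_equality)
    fix S' assume "jdt_slide\<^sup>*\<^sup>* (Gamma w) S' \<and> is_straight S'"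
    then show "S' = S" using straight S inj_onD[OF inj_on_row_word] by metis
  qed (use S in simp)
  then show "Gamma_tilde w \<in> straight_SYT n 3" "row_word n (Gamma_tilde w) = recording w"
    using straight[OF S] by (simp_all add: Gamma_tilde_def)
qed

theorem proposition4p4:
  fixes n :: nat
  shows "bij_betw Gamma_tilde (motzkin_paths n) (straight_SYT n 3) \<and>
         (\<forall>M \<in> motzkin_paths n. path_Des M = tableau_Des (Gamma_tilde M))"
proof (intro conjI ballI)
  \<comment> \<open>On Motzkin paths \<open>recording\<close> is \<open>row_word n\<close> after
    \<open>Gamma_tilde\<close>, and \<open>row_word n\<close> is injective on straight tableaux, so
    bijectivity passes to \<open>Gamma_tilde\<close>.\<close>
  note rec = bij_betw_recording[of n]
  show "bij_betw Gamma_tilde (motzkin_paths n) (straight_SYT n 3)"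
  proof (rule bij_betw_imageI)
    show "inj_on Gamma_tilde (motzkin_paths n)"
      using Gamma_tilde_correct(2) bij_betw_imp_inj_on[OF rec] unfolding inj_on_def by metis
    show "Gamma_tilde ` motzkin_paths n = straight_SYT n 3"
    proof (intro equalityI subsetI)
      fix S assume S: "S \<in> straight_SYT n 3"
      then have "row_word n S \<in> recording ` motzkin_paths n"
        using yamanouchi_row_word bij_betw_imp_surj_on[OF rec] by simp
      then obtain w where w: "w \<in> motzkin_paths n" "recording w = row_word n S" by force
      then have "Gamma_tilde w = S"
        using Gamma_tilde_correct[OF w(1)] S inj_onD[OF inj_on_row_word] by metis
      then show "S \<in> Gamma_tilde ` motzkin_paths n" using w(1) by blast
    qed (use Gamma_tilde_correct(1) in blast)
  qed
next
  fix w assume "w \<in> motzkin_paths n"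
  from Gamma_tilde_correct[OF this] show "path_Des w = tableau_Des (Gamma_tilde w)"
    using tableau_Des_row_word path_Des_recording unfolding straight_SYT_iff by metis
qed

end
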